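(* Let $f\in L^1([-\pi,\pi])$ have real Fourier coefficients and be $2\pi$-periodically extended to $\mathbb{R}$. Let $Y_n\in\mathbb{R}^{n\times n}$ be the anti-identity matrix and let $T_n[f]\in\mathbb{R}^{n\times n}$ be the Toeplitz matrix generated by $f$. Then \[ \{Y_nT_n[f]\}_n\sim_\lambda \psi_{|f|} \] over the domain $\tilde D=[-2\pi,2\pi]$, where \[ \psi_{|f|}(\theta)=\begin{cases} |f(\theta)|, & \theta\in[0,2\pi],\\ -|f(\theta+2\pi)|, & \theta\in[-2\pi,0).\end{cases} \]
   Context: The function $f$ is complex-valued and Lebesgue integrable. Its Fourier coefficients are $a_k=\frac{1}{2\pi}\int_{-\pi}^{\pi}f(\theta)e^{-\mathbf{i}k\theta}\,d\theta$, $k\in\mathbb{Z}$. The Toeplitz matrix generated by $f$ is the $n\times n$ matrix with entries $[T_n[f]]_{s,t}=a_{s-t}$, $s,t\in\{1,\dots,n\}$. The anti-identity (flip) matrix $Y_n$ has entries $[Y_n]_{s,t}=1$ if $s+t=n+1$ and $0$ otherwise. Eigenvalue distribution: for $n\times n$ matrices $X_n$ and a measurable function $h:\Omega\subset\mathbb{R}\to\mathbb{C}$ with $0<\mu_1(\Omega)<\infty$ ($\mu_1$ Lebesgue measure), $\{X_n\}_n\sim_\lambda h$ over $\Omega$ means \[ \lim_{n\to\infty}\frac1n\sum_{j=1}^nF(\lambda_j(X_n))=\frac{1}{\mu_1(\Omega)}\int_\Omega F(h(\theta))\,d\theta \] for every complex-valued continuous $F$ on $\mathbb{C}$ with bounded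 support, where $\lambda_j(X_n)$ are the eigenvalues of $X_n$ counted with multiplicity. *)

theory Defs
  imports "HOL-Analysis.Analysis" "Jordan_Normal_Form.Char_Poly"
begin

definition fourier_coeff :: "(real \<Rightarrow> complex) \<Rightarrow> int \<Rightarrow> complex" where
  "fourier_coeff f k =
     complex_of_real (1 / (2 * pi)) *
       (LINT \<theta>:{-pi..pi}|lebesgue. f \<theta> * exp (- \<i> * of_int k * complex_of_real \<theta>))"

text \<open>Matrix indices start at \<open>0\<close>: the difference \<open>s - t\<close> is unaffected by the shift, while the
  condition \<open>s + t = n + 1\<close> for the anti-identity becomes \<open>s + t + 1 = n\<close>.\<close>

definition toeplitz_mat :: "(real \<Rightarrow> complex) \<Rightarrow> nat \<Rightarrow> complex mat" where
  "toeplitz_mat f n = Matrix.mat n n (\<lambda>(s, t). fourier_coeff f (int s - int t))"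

definition anti_identity_mat :: "nat \<Rightarrow> complex mat" where
  "anti_identity_mat n = Matrix.mat n n (\<lambda>(s, t). if s + t + 1 = n then 1 else 0)"

text \<open>The multiset \<open>proots (char_poly A)\<close> lists the eigenvalues of a complex matrix \<open>A\<close> with their
  algebraic multiplicities. The standing requirements on the matrices, on the domain and on the
  measurability of the symbol are part of the predicate.\<close>

definition eigenvalue_distribution ::
    "(nat \<Rightarrow> complex mat) \<Rightarrow> (real \<Rightarrow> complex) \<Rightarrow> real set \<Rightarrow> bool" where
  "eigenvalue_distribution X h \<Omega> \<longleftrightarrow>
     (\<forall>n. X n \<in> carrier_mat n n) \<and>
     \<Omega> \<in> lmeasurable \<and> 0 < measure lebesgue \<Omega> \<and>
     h \<in> borel_measurable (lebesgue_on \<Omega>) \<and>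
     (\<forall>F :: complex \<Rightarrow> complex.
        continuous_on UNIV F \<and> bounded {z. F z \<noteq> 0} \<longrightarrow>
        (\<lambda>n. 1 / of_nat n * (\<Sum>z\<in>#proots (char_poly (X n)). F z))
          \<longlonglongrightarrow> 1 / complex_of_real (measure lebesgue \<Omega>) * (LINT \<theta>:\<Omega>|lebesgue. F (h \<theta>)))"

text \<open>Only the values on \<open>{-2 * pi..2 * pi}\<close> are meaningful.\<close>

definition psi :: "(real \<Rightarrow> real) \<Rightarrow> real \<Rightarrow> real" where
  "psi g \<theta> = (if 0 \<le> \<theta> then g \<theta> else - g (\<theta> + 2 * pi))"

end

theory Submission
  imports Defs "Jordan_Normal_Form.Schur_Decomposition" "HOL-Probability.Probability"
begin

text \<open>The matrices \<open>H\<^sub>n[f] = Y\<^sub>n T\<^sub>n[f]\<close> are real symmetric Hankel matrices, so by Levy's continuity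
  theorem it suffices to show that the characteristic functions \<open>(1/n) \<Sum>\<^sub>j exp(\<i> t \<lambda>\<^sub>j)\<close> of their empirical
  spectral measures converge to \<open>(1/2\<pi>) \<integral> cos(t |f|)\<close>. Both sides are Lipschitz in \<open>f\<close> for the \<open>L\<^sup>1\<close>
  norm, uniformly in \<open>n\<close>: differentiating \<open>tr (exp(\<i> s H[f]) exp(\<i> (t - s) H[g]))\<close> in \<open>s\<close> leaves a trace
  against \<open>H[f - g] = (1/2\<pi>) \<integral> (f - g)(\<theta>) exp(-\<i> (n - 1) \<theta>) v(\<theta>) v(\<theta>)\<^sup>T d\<theta>\<close>, where
  \<open>v(\<theta>)\<close> has the entries \<open>exp(\<i> s \<theta>)\<close>. By the \<open>L\<^sup>1\<close> convergence of Fejer means, which keep the Fourier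
  coefficients real, one may assume that \<open>f\<close> is a trigonometric polynomial \<open>q\<close>.

  For \<open>q\<close> the moments converge. Away from the ends of the index range \<open>H[q]\<close> maps \<open>v(\<theta>)\<close> to a
  multiple of \<open>v(-\<theta>)\<close>, and two steps multiply \<open>v(\<theta>)\<close> by \<open>q(\<theta>) q(-\<theta>) = |q(\<theta>)|\<^sup>2\<close>. Hence all but boundedly
  many diagonal entries of \<open>H[q]\<close> to the power \<open>2k\<close> equal \<open>(1/2\<pi>) \<integral> |q|\<close> to the power \<open>2k\<close>, while odd
  powers are supported near the antidiagonal and have bounded trace.\<close>

subsection \<open>Spectral decomposition of Hermitian matrices\<close>

text \<open>By Schur triangularization and cyclicity of the trace, the trace is the sum of the roots
  \<open>es\<close> of the characteristic polynomial. If all of them were \<open>c\<close>, it would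
  be \<open>n * c\<close>.\<close>

lemma exists_eigenvector_ne:
  fixes M :: "complex mat"
  assumes M: "M \<in> carrier_mat n n" and tr: "(\<Sum>i<n. M $$ (i,i)) \<noteq> of_nat n * c"
  shows "\<exists>e y. e \<noteq> c \<and> eigenvector M y e"
proof -
  obtain es where es: "char_poly M = (\<Prod>e\<leftarrow>es. [:- e, 1:])" and len: "length es = n"
    using char_poly_factorized[OF M] by auto
  obtain B P Q where BPQ: "schur_decomposition M es = (B, P, Q)"
    by (metis prod_cases3)
  from schur_decomposition[OF M es BPQ]
  have sim: "similar_mat_wit M B P Q" and diag: "diag_mat B = es" by auto
  from similar_mat_witD2[OF M sim]
  have QP: "Q * P = 1\<^sub>m n" and eq: "M = P * B * Q"
    and B: "B \<in> carrier_mat n n" and P: "P \<in> carrier_mat n n" and Q: "Q \<in> carrier_mat n n"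
    by auto
  have "(\<Sum>i<n. M $$ (i,i)) = (\<Sum>i<n. \<Sum>l<n. \<Sum>k<n. P $$ (i,l) * (B $$ (l,k) * Q $$ (k,i)))"
    unfolding eq using P B Q
    by (auto simp: scalar_prod_def sum_distrib_left lessThan_atLeast0 intro!: sum.cong)
  also have "\<dots> = (\<Sum>l<n. \<Sum>i<n. \<Sum>k<n. B $$ (l,k) * (Q $$ (k,i) * P $$ (i,l)))"
    by (subst sum.swap) (simp add: mult_ac)
  also have "\<dots> = (\<Sum>l<n. \<Sum>k<n. B $$ (l,k) * (\<Sum>i<n. Q $$ (k,i) * P $$ (i,l)))"
    unfolding sum_distrib_left by (intro sum.cong refl sum.swap)
  also have "\<dots> = (\<Sum>l<n. \<Sum>k<n. B $$ (l,k) * (Q * P) $$ (k,l))"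
    using P Q by (auto simp: scalar_prod_def lessThan_atLeast0 intro!: sum.cong)
  also have "\<dots> = (\<Sum>l<n. \<Sum>k<n. if k = l then B $$ (l,k) else 0)"
    unfolding QP by (intro sum.cong refl) auto
  also have "\<dots> = (\<Sum>l<n. B $$ (l,l))" by simp
  also have "\<dots> = (\<Sum>l<n. es ! l)"
    using B by (auto simp flip: diag simp: diag_mat_def intro!: sum.cong)
  finally have trace: "(\<Sum>i<n. M $$ (i,i)) = (\<Sum>l<n. es ! l)" .
  obtain l where l: "l < n" "es ! l \<noteq> c"
    using tr unfolding trace by (cases "\<forall>l<n. es ! l = c") auto
  have "poly (char_poly M) (es ! l) = 0"
    unfolding es poly_prod_list using l len
    by (auto simp: prod_list_zero_iff intro!: image_eqI[of _ _ "es ! l"])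
  then have "eigenvalue M (es ! l)" using eigenvalue_root_char_poly[OF M] by simp
  then show ?thesis using l(2) unfolding eigenvalue_def by blast
qed

lemma exists_eigenfunction_ne:
  fixes m :: "nat \<Rightarrow> nat \<Rightarrow> complex"
  assumes tr: "(\<Sum>i<n. m i i) \<noteq> of_nat n * c"
  obtains e y where "e \<noteq> c" "\<And>s. s < n \<Longrightarrow> (\<Sum>t<n. m s t * y t) = e * y s" "\<exists>s<n. y s \<noteq> 0"
proof -
  define M where "M = Matrix.mat n n (\<lambda>(i,j). m i j)"
  have M: "M \<in> carrier_mat n n" by (simp add: M_def)
  have "(\<Sum>i<n. M $$ (i,i)) \<noteq> of_nat n * c" using tr by (simp add: M_def)
  from exists_eigenvector_ne[OF M this] obtain e y where e: "e \<noteq> c" and ev: "eigenvector M y e"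
    by blast
  have y: "y \<in> carrier_vec n" and y0: "y \<noteq> 0\<^sub>v n" and My: "M *\<^sub>v y = e \<cdot>\<^sub>v y"
    using ev M unfolding eigenvector_def by auto
  have "(\<Sum>t<n. m s t * vec_index y t) = e * vec_index y s" if s: "s < n" for s
  proof -
    have "vec_index (M *\<^sub>v y) s = vec_index (e \<cdot>\<^sub>v y) s" using My by simp
    then show ?thesis using s y M by (simp add: scalar_prod_def M_def lessThan_atLeast0)
  qed
  moreover have "\<exists>s<n. vec_index y s \<noteq> 0"
    using y y0 by (metis eq_vecI carrier_vecD index_zero_vec(1) index_zero_vec(2))
  ultimately show thesis using that e by blast
qed

text \<open>Deflation: replacing the known eigenvalues by a common value \<open>\<mu>\<close> that is not the average of
  the remaining ones produces an eigenvector for another eigenvalue, which is then orthogonal to the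
  known eigenvectors.\<close>

lemma hermitian_partial_eigenbasis:
  fixes a :: "nat \<Rightarrow> nat \<Rightarrow> complex"
  assumes herm: "\<And>s t. s < n \<Longrightarrow> t < n \<Longrightarrow> a t s = cnj (a s t)"
  shows "k \<le> n \<Longrightarrow> \<exists>(l :: nat \<Rightarrow> real) u.
    (\<forall>i<k. \<forall>s<n. (\<Sum>t<n. a s t * u t i) = of_real (l i) * u s i) \<and>
    (\<forall>i<k. \<forall>j<k. (\<Sum>s<n. cnj (u s i) * u s j) = (if i = j then 1 else 0))"
proof (induction k)
  case 0
  then show ?case by simp
next
  case (Suc k)
  from Suc.IH[OF Suc_leD[OF Suc.prems]] obtain l :: "nat \<Rightarrow> real" and u where
    ev: "\<And>i s. i < k \<Longrightarrow> s < n \<Longrightarrow> (\<Sum>t<n. a s t * u t i) = of_real (l i) * u s i" and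
    on: "\<And>i j. i < k \<Longrightarrow> j < k \<Longrightarrow> (\<Sum>s<n. cnj (u s i) * u s j) = (if i = j then 1 else 0)"
    by (elim exE conjE) blast
  have k: "k < n" using Suc.prems by simp
  have hc: "cnj (a s t) = a t s" if "s < n" "t < n" for s t using herm[OF that] by simp
  \<comment> \<open>The quotient is the average of the eigenvalues still missing. Adding 1 makes the
    trace of \<open>m\<close> below differ from \<open>n * \<mu>\<close> by the positive number
    \<open>n - k\<close>.\<close>
  define \<mu> :: complex where "\<mu> = ((\<Sum>i<n. a i i) - (\<Sum>i<k. of_real (l i))) / of_nat (n - k) + 1"
  \<comment> \<open>Each known \<open>u _ i\<close> becomes an eigenvector of \<open>m\<close> for
    \<open>\<mu>\<close>, while on the orthogonal complement of these vectors \<open>m\<close> acts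
    as \<open>a\<close>.\<close>
  define m where "m s t = a s t + (\<Sum>i<k. (\<mu> - of_real (l i)) * u s i * cnj (u t i))" for s t
  have "(\<Sum>s<n. m s s) = (\<Sum>s<n. a s s) + (\<Sum>i<k. (\<mu> - of_real (l i)) * (\<Sum>s<n. cnj (u s i) * u s i))"
    unfolding m_def sum.distrib sum_distrib_left by (subst sum.swap) (simp add: mult_ac)
  also have "\<dots> = (\<Sum>s<n. a s s) - (\<Sum>i<k. of_real (l i)) + of_nat k * \<mu>"
    by (simp add: on sum_subtractf)
  also have "\<dots> = of_nat (n - k) * (\<mu> - 1) + of_nat k * \<mu>"
    using k by (simp add: \<mu>_def)
  also have "\<dots> = of_nat n * \<mu> - of_nat (n - k)"
    using k by (simp add: of_nat_diff algebra_simps)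
  finally have "(\<Sum>s<n. m s s) \<noteq> of_nat n * \<mu>" using k by simp
  from exists_eigenfunction_ne[of m n \<mu>, OF this] obtain e y where e: "e \<noteq> \<mu>" and
    my: "\<And>s. s < n \<Longrightarrow> (\<Sum>t<n. m s t * y t) = e * y s" and y0: "\<exists>s<n. y s \<noteq> 0" by blast
  have my': "(\<Sum>t<n. m s t * y t) = (\<Sum>t<n. a s t * y t)
      + (\<Sum>i<k. (\<mu> - of_real (l i)) * u s i * (\<Sum>t<n. cnj (u t i) * y t))" for s
  proof -
    have "(\<Sum>t<n. m s t * y t) = (\<Sum>t<n. a s t * y t)
      + (\<Sum>t<n. \<Sum>i<k. (\<mu> - of_real (l i)) * u s i * (cnj (u t i) * y t))"
      unfolding m_def by (simp add: algebra_simps sum.distrib sum_distrib_left sum_distrib_right)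
    also have "(\<Sum>t<n. \<Sum>i<k. (\<mu> - of_real (l i)) * u s i * (cnj (u t i) * y t))
      = (\<Sum>i<k. (\<mu> - of_real (l i)) * u s i * (\<Sum>t<n. cnj (u t i) * y t))"
      unfolding sum_distrib_left by (rule sum.swap)
    finally show ?thesis .
  qed
  \<comment> \<open>Pairing \<open>m y = e y\<close> with \<open>u _ j\<close> gives the overlap
    times \<open>e\<close> on one side and times \<open>\<mu>\<close> on the other; since
    \<open>e\<close> differs from \<open>\<mu>\<close>, the overlap vanishes.\<close>
  have orth: "(\<Sum>s<n. cnj (u s j) * y s) = 0" if j: "j < k" for j
  proof -
    have "e * (\<Sum>s<n. cnj (u s j) * y s) = (\<Sum>s<n. cnj (u s j) * (\<Sum>t<n. m s t * y t))"
      unfolding sum_distrib_left[of e] by (intro sum.cong refl) (simp add: my mult.left_commute)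
    also have "\<dots> = (\<Sum>s<n. cnj (u s j) * (\<Sum>t<n. a s t * y t))
       + (\<Sum>s<n. \<Sum>i<k. (\<mu> - of_real (l i)) * (cnj (u s j) * u s i) * (\<Sum>t<n. cnj (u t i) * y t))"
      unfolding my' by (simp add: algebra_simps sum.distrib sum_distrib_left)
    also have "(\<Sum>s<n. \<Sum>i<k. (\<mu> - of_real (l i)) * (cnj (u s j) * u s i) * (\<Sum>t<n. cnj (u t i) * y t))
       = (\<Sum>i<k. (\<mu> - of_real (l i)) * (\<Sum>s<n. cnj (u s j) * u s i) * (\<Sum>t<n. cnj (u t i) * y t))"
      by (subst sum.swap) (simp flip: sum_distrib_left sum_distrib_right)
    also have "\<dots> = (\<Sum>i<k. if i = j then (\<mu> - of_real (l i)) * (\<Sum>t<n. cnj (u t i) * y t) else 0)"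
      using j by (intro sum.cong refl) (auto simp: on)
    also have "\<dots> = (\<mu> - of_real (l j)) * (\<Sum>t<n. cnj (u t j) * y t)"
      using j by simp
    also have "(\<Sum>s<n. cnj (u s j) * (\<Sum>t<n. a s t * y t)) = (\<Sum>t<n. cnj (\<Sum>s<n. a t s * u s j) * y t)"
      unfolding sum_distrib_left cnj_sum sum_distrib_right
      by (subst sum.swap, intro sum.cong refl) (simp add: hc mult_ac)
    also have "\<dots> = of_real (l j) * (\<Sum>t<n. cnj (u t j) * y t)"
      unfolding sum_distrib_left by (intro sum.cong refl) (simp add: ev j)
    finally have "(e - \<mu>) * (\<Sum>s<n. cnj (u s j) * y s) = 0" by (simp add: algebra_simps)
    then show ?thesis using e by simp
  qed
  have ay: "(\<Sum>t<n. a s t * y t) = e * y s" if "s < n" for s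
    using my[OF that] my'[of s] by (simp add: orth)
  define N where "N = (\<Sum>s<n. (cmod (y s))\<^sup>2)"
  have yy: "(\<Sum>s<n. cnj (y s) * y s) = of_real N"
    unfolding N_def of_real_sum complex_norm_square by (simp only: mult.commute)
  have N: "N > 0"
    using y0 unfolding N_def by (auto intro!: sum_pos2)
  \<comment> \<open>A Hermitian form takes real values on the diagonal, and \<open>e\<close> is such
    a value divided by \<open>N\<close>.\<close>
  have eN: "e * of_real N = (\<Sum>s<n. cnj (y s) * (\<Sum>t<n. a s t * y t))"
    unfolding yy[symmetric] sum_distrib_left[of e]
    by (intro sum.cong refl) (simp add: ay mult.left_commute)
  also have "\<dots> = cnj (\<Sum>s<n. cnj (y s) * (\<Sum>t<n. a s t * y t))"
    unfolding sum_distrib_left cnj_sum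
    by (subst sum.swap, intro sum.cong refl) (simp add: hc mult_ac)
  also have "\<dots> = cnj (e * of_real N)"
    unfolding eN ..
  also have "\<dots> = cnj e * of_real N" by simp
  finally have er: "e = of_real (Re e)"
    using N by (simp add: complex_eq_iff)
  define u' where "u' s i = (if i = k then y s / of_real (sqrt N) else u s i)" for s i
  define l' where "l' i = (if i = k then Re e else l i)" for i
  have sq: "complex_of_real (sqrt N) * complex_of_real (sqrt N) = of_real N"
    using N by (simp flip: of_real_mult)
  have "(\<Sum>t<n. a s t * u' t i) = of_real (l' i) * u' s i" if "i < Suc k" "s < n" for i s
    using that ev[of i s] ay[of s] er
    by (cases "i = k") (simp_all add: u'_def l'_def less_Suc_eq flip: sum_divide_distrib)
  moreover have "(\<Sum>s<n. cnj (u' s i) * u' s j) = (if i = j then 1 else 0)"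
    if ij: "i < Suc k" "j < Suc k" for i j
  proof -
    have *: "(\<Sum>s<n. cnj (y s) * u s j) = 0" if "j < k" for j
      using arg_cong[OF orth[OF that], of cnj] by (simp add: mult.commute)
    consider "i = k" "j = k" | "i = k" "j < k" | "i < k" "j = k" | "i < k" "j < k"
      using ij by linarith
    then show ?thesis
    proof cases
      case 1
      then show ?thesis using N yy sq by (simp add: u'_def flip: sum_divide_distrib)
    qed (simp_all add: u'_def on orth * flip: sum_divide_distrib)
  qed
  ultimately show ?case by blast
qed

text \<open>The \<open>i\<close>-th eigenvector has the components \<open>u s i\<close>. Both
  relations of a unitary matrix are recorded, for its columns and for its rows; index functions
  instead of matrices let sums be interchanged without carrier conditions.\<close>

definition spectral_data :: "nat \<Rightarrow> (nat \<Rightarrow> nat \<Rightarrow> complex) \<Rightarrow> (nat \<Rightarrow> real) \<Rightarrow> (nat \<Rightarrow> nat \<Rightarrow> complex) \<Rightarrow> bool"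
  where "spectral_data n a l u \<longleftrightarrow>
    (\<forall>i<n. \<forall>s<n. (\<Sum>t<n. a s t * u t i) = of_real (l i) * u s i) \<and>
    (\<forall>i<n. \<forall>j<n. (\<Sum>s<n. cnj (u s i) * u s j) = (if i = j then 1 else 0)) \<and>
    (\<forall>s<n. \<forall>t<n. (\<Sum>i<n. u s i * cnj (u t i)) = (if s = t then 1 else 0))"

text \<open>The eigenvectors form a unitary \<open>U\<close> that diagonalizes \<open>A\<close>. By
  similarity the characteristic polynomial is that of the diagonal matrix, so \<open>l\<close> lists
  the eigenvalues with their algebraic multiplicities.\<close>

lemma hermitian_spectral:
  assumes A: "A \<in> carrier_mat n n"
    and herm: "\<And>s t. s < n \<Longrightarrow> t < n \<Longrightarrow> A $$ (t,s) = cnj (A $$ (s,t))"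
  obtains l u where "spectral_data n (\<lambda>s t. A $$ (s,t)) l u"
    and "proots (char_poly A) = image_mset (\<lambda>i. complex_of_real (l i)) (mset_set {..<n})"
proof -
  obtain l :: "nat \<Rightarrow> real" and u where
    ev: "\<And>i s. i < n \<Longrightarrow> s < n \<Longrightarrow> (\<Sum>t<n. A $$ (s,t) * u t i) = of_real (l i) * u s i" and
    on: "\<And>i j. i < n \<Longrightarrow> j < n \<Longrightarrow> (\<Sum>s<n. cnj (u s i) * u s j) = (if i = j then 1 else 0)"
    using hermitian_partial_eigenbasis[of n "\<lambda>s t. A $$ (s,t)" n] herm by blast
  define U where "U = Matrix.mat n n (\<lambda>(s,i). u s i)"
  define V where "V = Matrix.mat n n (\<lambda>(i,s). cnj (u s i))"
  define D where "D = Matrix.mat n n (\<lambda>(i,j). if i = j then complex_of_real (l i) else 0)"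
  have c: "U \<in> carrier_mat n n" "V \<in> carrier_mat n n" "D \<in> carrier_mat n n"
    by (simp_all add: U_def V_def D_def)
  have VU: "V * U = 1\<^sub>m n"
    by (rule eq_matI) (auto simp: U_def V_def scalar_prod_def on[unfolded lessThan_atLeast0])
  \<comment> \<open>For square matrices a left inverse is a right inverse; this yields the
    completeness clause of \<open>spectral_data\<close>.\<close>
  then have UV: "U * V = 1\<^sub>m n" using mat_mult_left_right_inverse c by blast
  have AU: "A * U = U * D"
  proof (rule eq_matI)
    fix i j assume ij: "i < dim_row (U * D)" "j < dim_col (U * D)"
    have "(U * D) $$ (i,j) = (\<Sum>k<n. u i k * (if k = j then of_real (l k) else 0))"
      using ij c by (simp add: scalar_prod_def U_def D_def lessThan_atLeast0)
    also have "\<dots> = (\<Sum>k<n. if k = j then u i k * of_real (l k) else 0)"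
      by (intro sum.cong refl) simp
    finally have "(U * D) $$ (i,j) = (\<Sum>k<n. if k = j then u i k * of_real (l k) else 0)" .
    then show "(A * U) $$ (i,j) = (U * D) $$ (i,j)"
      using ij c A ev by (simp add: scalar_prod_def U_def lessThan_atLeast0 mult.commute)
  qed (use A c in auto)
  have "A = A * (U * V)" using A UV by simp
  also have "\<dots> = U * D * V" using A c AU by (metis assoc_mult_mat)
  finally have "A = U * D * V" .
  then have "similar_mat_wit A D U V"
    using A c UV VU by (intro similar_mat_witI[of _ _ n]) auto
  then have "char_poly A = char_poly D" using char_poly_similar similar_mat_def by blast
  also have "\<dots> = (\<Prod>a\<leftarrow>diag_mat D. [:- a, 1:])"
    by (rule char_poly_upper_triangular[of _ n]) (use c in \<open>auto simp: D_def\<close>)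
  finally have cp: "char_poly A = (\<Prod>a\<leftarrow>diag_mat D. [:- a, 1:])" .
  have dm: "diag_mat D = map (\<lambda>i. complex_of_real (l i)) [0..<n]"
    by (auto simp: diag_mat_def D_def)
  have pr: "proots (\<Prod>x\<leftarrow>xs. [:- f x, 1:]) = image_mset f (mset xs)" for xs :: "nat list" and f :: "nat \<Rightarrow> complex"
  proof (induction xs)
    case (Cons x xs)
    have "(\<Prod>x\<leftarrow>xs. [:- f x, 1:]) \<noteq> 0" by (auto simp: prod_list_zero_iff)
    then show ?case using Cons by (simp add: proots_mult del: mult_pCons_left)
  qed simp
  have "proots (char_poly A) = image_mset (\<lambda>i. complex_of_real (l i)) (mset_set {..<n})"
    unfolding cp dm using pr[of "\<lambda>i. complex_of_real (l i)" "[0..<n]"]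
    by (simp add: comp_def atLeast0LessThan)
  moreover have "(\<Sum>i<n. u s i * cnj (u t i)) = (if s = t then 1 else 0)" if "s < n" "t < n" for s t
    using arg_cong[OF UV, of "\<lambda>M. M $$ (s,t)"] that
    by (simp add: U_def V_def scalar_prod_def lessThan_atLeast0)
  ultimately show thesis using that ev on unfolding spectral_data_def by blast
qed

subsection \<open>Lipschitz dependence of the spectrum on the symbol\<close>

abbreviation leb :: "real measure" where "leb \<equiv> lebesgue_on {-pi..pi}"

lemma integrable_leb_iff:
  "integrable leb f \<longleftrightarrow> f absolutely_integrable_on {-pi..pi}" for f :: "real \<Rightarrow> complex"
  by (simp add: integrable_restrict_space set_integrable_def)

lemma fourier_coeff_leb:
  "fourier_coeff f k = complex_of_real (1 / (2 * pi)) * (LINT \<theta>|leb. f \<theta> * cis (- (of_int k * \<theta>)))"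
  unfolding fourier_coeff_def set_lebesgue_integral_def
  by (simp add: integral_restrict_space cis_conv_exp mult_ac)

lemma borel_measurable_leb_continuous:
  "continuous_on UNIV g \<Longrightarrow> g \<in> borel_measurable leb" for g :: "real \<Rightarrow> 'a::topological_space"
  by (intro measurable_restrict_space1 measurable_completion) (simp add: borel_measurable_continuous_onI)

lemma integrable_leb_times_bounded:
  fixes f g :: "real \<Rightarrow> complex"
  assumes f: "integrable leb f" and g: "continuous_on UNIV g" and b: "\<And>x. norm (g x) \<le> B"
  shows "integrable leb (\<lambda>x. f x * g x)"
proof (rule Bochner_Integration.integrable_bound)
  show "integrable leb (\<lambda>x. B * norm (f x))" using f by simp
  show "(\<lambda>x. f x * g x) \<in> borel_measurable leb"
    using f borel_measurable_leb_continuous[OF g] by (auto intro!: borel_measurable_times)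
  show "AE x in leb. norm (f x * g x) \<le> norm (B * norm (f x))"
  proof (intro AE_I2)
    fix x
    have "norm (f x * g x) \<le> norm (f x) * B" unfolding norm_mult by (intro mult_left_mono b) simp
    then show "norm (f x * g x) \<le> norm (B * norm (f x))"
      by (metis mult.commute norm_ge_zero abs_ge_self order_trans real_norm_def)
  qed
qed

lemma integrable_leb_times_cis:
  "integrable leb f \<Longrightarrow> integrable leb (\<lambda>x. f x * cis (c * x))" for f :: "real \<Rightarrow> complex"
  by (rule integrable_leb_times_bounded[where B=1]) (auto intro!: continuous_intros)

text \<open>Expanding the squares leaves the Gram sums over \<open>i\<close>, and the hypothesis
  removes the off-diagonal ones. It is applied to eigenvector arrays and also to their conjugates
  and transposes.\<close>

lemma parseval:
  fixes v :: "nat \<Rightarrow> nat \<Rightarrow> complex"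
  assumes "\<And>s t. s < n \<Longrightarrow> t < n \<Longrightarrow> (\<Sum>i<n. v s i * cnj (v t i)) = (if s = t then 1 else 0)"
  shows "(\<Sum>i<n. (cmod (\<Sum>s<n. v s i * y s))\<^sup>2) = (\<Sum>s<n. (cmod (y s))\<^sup>2)"
proof -
  have "complex_of_real (\<Sum>i<n. (cmod (\<Sum>s<n. v s i * y s))\<^sup>2)
      = (\<Sum>i<n. \<Sum>s<n. \<Sum>t<n. (y s * cnj (y t)) * (v s i * cnj (v t i)))"
    unfolding of_real_sum complex_norm_square cnj_sum sum_product
    by (intro sum.cong refl) (simp add: mult_ac)
  also have "\<dots> = (\<Sum>s<n. \<Sum>i<n. \<Sum>t<n. (y s * cnj (y t)) * (v s i * cnj (v t i)))"
    by (rule sum.swap)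
  also have "\<dots> = (\<Sum>s<n. \<Sum>t<n. (y s * cnj (y t)) * (\<Sum>i<n. v s i * cnj (v t i)))"
    unfolding sum_distrib_left by (intro sum.cong refl sum.swap)
  also have "\<dots> = (\<Sum>s<n. \<Sum>t<n. if t = s then y s * cnj (y t) else 0)"
    by (intro sum.cong refl) (auto simp: assms)
  also have "\<dots> = complex_of_real (\<Sum>s<n. (cmod (y s))\<^sup>2)"
    unfolding of_real_sum complex_norm_square by simp
  finally show ?thesis by (simp only: of_real_eq_iff)
qed

section \<open>Comparison of two spectral decompositions\<close>

lemma spectral_dataD:
  assumes "spectral_data n a l u"
  shows "\<And>i s. i < n \<Longrightarrow> s < n \<Longrightarrow> (\<Sum>t<n. a s t * u t i) = of_real (l i) * u s i"
    and "\<And>i j. i < n \<Longrightarrow> j < n \<Longrightarrow> (\<Sum>s<n. cnj (u s i) * u s j) = (if i = j then 1 else 0)"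
    and "\<And>s t. s < n \<Longrightarrow> t < n \<Longrightarrow> (\<Sum>i<n. u s i * cnj (u t i)) = (if s = t then 1 else 0)"
  using assms unfolding spectral_data_def by blast+

lemma spectral_data_decomposition:
  assumes "spectral_data n a l u" "s < n" "t < n"
  shows "a s t = (\<Sum>i<n. of_real (l i) * u s i * cnj (u t i))"
proof -
  note sd = spectral_dataD[OF assms(1)]
  have "a s t = (\<Sum>r<n. if r = t then a s r else 0)" using assms by simp
  also have "\<dots> = (\<Sum>r<n. a s r * (\<Sum>i<n. u r i * cnj (u t i)))"
    using assms by (intro sum.cong refl) (simp add: sd)
  also have "\<dots> = (\<Sum>i<n. (\<Sum>r<n. a s r * u r i) * cnj (u t i))"
    unfolding sum_distrib_left sum_distrib_right mult.assoc by (rule sum.swap)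
  finally show ?thesis using assms by (simp add: sd)
qed

text \<open>This is the left eigenvector relation, read off from the spectral decomposition of
  \<open>a\<close>.\<close>

lemma spectral_data_left:
  assumes sd: "spectral_data n a l u" and i: "i < n" and t: "t < n"
  shows "(\<Sum>s<n. cnj (u s i) * a s t) = of_real (l i) * cnj (u t i)"
proof -
  have "(\<Sum>s<n. cnj (u s i) * a s t)
      = (\<Sum>s<n. \<Sum>j<n. of_real (l j) * cnj (u t j) * (cnj (u s i) * u s j))"
    using t by (intro sum.cong refl) (simp add: spectral_data_decomposition[OF sd] sum_distrib_left mult_ac)
  also have "\<dots> = (\<Sum>j<n. of_real (l j) * cnj (u t j) * (\<Sum>s<n. cnj (u s i) * u s j))"
    unfolding sum_distrib_left by (rule sum.swap)
  also have "\<dots> = (\<Sum>j<n. if j = i then of_real (l j) * cnj (u t j) else 0)"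
    using i by (intro sum.cong refl) (auto simp: spectral_dataD[OF sd])
  finally show ?thesis using i by simp
qed

text \<open>With the sum over \<open>s\<close> outermost, the form is a product sum of two vectors
  whose norms are those of \<open>x\<close> and \<open>y\<close> by Parseval; Cauchy-Schwarz gives
  the bound.\<close>

lemma overlap_form_bound:
  assumes u: "spectral_data n a l u" and w: "spectral_data n b m w"
  shows "cmod (\<Sum>i<n. \<Sum>j<n. cnj (\<Sum>s<n. cnj (u s i) * w s j) * (x i * y j))
    \<le> sqrt (\<Sum>i<n. (cmod (x i))\<^sup>2) * sqrt (\<Sum>j<n. (cmod (y j))\<^sup>2)"
proof -
  have "(\<Sum>i<n. \<Sum>j<n. cnj (\<Sum>s<n. cnj (u s i) * w s j) * (x i * y j))
      = (\<Sum>i<n. \<Sum>s<n. \<Sum>j<n. (u s i * x i) * (cnj (w s j) * y j))"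
    unfolding cnj_sum sum_distrib_right
    by (intro sum.cong refl trans[OF sum.swap]) (simp add: mult_ac)
  also have "\<dots> = (\<Sum>s<n. (\<Sum>i<n. u s i * x i) * (\<Sum>j<n. cnj (w s j) * y j))"
    unfolding sum_product by (rule sum.swap)
  finally have "cmod (\<Sum>i<n. \<Sum>j<n. cnj (\<Sum>s<n. cnj (u s i) * w s j) * (x i * y j))
     \<le> (\<Sum>s<n. \<bar>cmod (\<Sum>i<n. u s i * x i)\<bar> * \<bar>cmod (\<Sum>j<n. cnj (w s j) * y j)\<bar>)"
    by (simp add: sum_norm_le norm_mult)
  also have "\<dots> \<le> L2_set (\<lambda>s. cmod (\<Sum>i<n. u s i * x i)) {..<n} * L2_set (\<lambda>s. cmod (\<Sum>j<n. cnj (w s j) * y j)) {..<n}"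
    by (rule L2_set_mult_ineq)
  also have "\<dots> = sqrt (\<Sum>i<n. (cmod (x i))\<^sup>2) * sqrt (\<Sum>j<n. (cmod (y j))\<^sup>2)"
    unfolding L2_set_def
    using parseval[of n "\<lambda>i s. u s i" x] parseval[of n "\<lambda>j s. cnj (w s j)" y]
      spectral_dataD(2)[OF u] spectral_dataD(2)[OF w]
    by (simp add: mult.commute)
  finally show ?thesis .
qed

text \<open>In the matrix element of \<open>a - b\<close> between \<open>u _ i\<close> and
  \<open>w _ j\<close>, \<open>a\<close> acts to the left and produces \<open>l i\<close>, while
  \<open>b\<close> acts to the right and produces \<open>m j\<close>.\<close>

lemma overlap_eigenvalue_difference:
  assumes u: "spectral_data n a l u" and w: "spectral_data n b m w" and ij: "i < n" "j < n"
  shows "(of_real (l i) - of_real (m j)) * (\<Sum>s<n. cnj (u s i) * w s j)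
    = (\<Sum>s<n. \<Sum>t<n. (a s t - b s t) * (cnj (u s i) * w t j))"
proof -
  have "(\<Sum>s<n. \<Sum>t<n. a s t * (cnj (u s i) * w t j)) = (\<Sum>t<n. (\<Sum>s<n. cnj (u s i) * a s t) * w t j)"
    unfolding sum_distrib_right by (subst sum.swap) (simp add: mult_ac)
  also have "\<dots> = of_real (l i) * (\<Sum>t<n. cnj (u t i) * w t j)"
    unfolding sum_distrib_left
    by (intro sum.cong refl) (use ij in \<open>simp add: spectral_data_left[OF u]\<close>)
  finally have 1: "(\<Sum>s<n. \<Sum>t<n. a s t * (cnj (u s i) * w t j)) = \<dots>" .
  have "(\<Sum>s<n. \<Sum>t<n. b s t * (cnj (u s i) * w t j)) = (\<Sum>s<n. cnj (u s i) * (\<Sum>t<n. b s t * w t j))"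
    unfolding sum_distrib_left by (simp add: mult_ac)
  also have "\<dots> = of_real (m j) * (\<Sum>t<n. cnj (u t i) * w t j)"
    unfolding sum_distrib_left[of "of_real (m j)"]
    by (intro sum.cong refl) (use ij in \<open>simp add: spectral_dataD[OF w] mult.left_commute\<close>)
  finally show ?thesis using 1 by (simp only: left_diff_distrib sum_subtractf)
qed

text \<open>The squared overlaps form a doubly stochastic matrix: each sum is Parseval for one basis
  applied to a unit vector of the other.\<close>

lemma overlap_sums:
  assumes u: "spectral_data n a l u" and w: "spectral_data n b m w"
  shows "\<And>i. i < n \<Longrightarrow> (\<Sum>j<n. (cmod (\<Sum>s<n. cnj (u s i) * w s j))\<^sup>2) = 1"
    and "\<And>j. j < n \<Longrightarrow> (\<Sum>i<n. (cmod (\<Sum>s<n. cnj (u s i) * w s j))\<^sup>2) = 1"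
proof -
  fix i assume i: "i < n"
  have "complex_of_real (\<Sum>s<n. (cmod (u s i))\<^sup>2) = 1"
    unfolding of_real_sum complex_norm_square using spectral_dataD(2)[OF u i i] by (simp add: mult.commute)
  then have "(\<Sum>s<n. (cmod (u s i))\<^sup>2) = 1" by (simp only: of_real_eq_1_iff)
  then show "(\<Sum>j<n. (cmod (\<Sum>s<n. cnj (u s i) * w s j))\<^sup>2) = 1"
    using parseval[of n w "\<lambda>s. cnj (u s i)"] spectral_dataD(3)[OF w] by (simp add: mult.commute)
next
  fix j assume j: "j < n"
  have "complex_of_real (\<Sum>s<n. (cmod (w s j))\<^sup>2) = 1"
    unfolding of_real_sum complex_norm_square using spectral_dataD(2)[OF w j j] by (simp add: mult.commute)
  then have "(\<Sum>s<n. (cmod (w s j))\<^sup>2) = 1" by (simp only: of_real_eq_1_iff)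
  moreover have "(\<Sum>i<n. cnj (u s i) * u t i) = (if s = t then 1 else 0)" if "s < n" "t < n" for s t
    using spectral_dataD(3)[OF u that(2,1)] by (auto simp: mult.commute)
  ultimately show "(\<Sum>i<n. (cmod (\<Sum>s<n. cnj (u s i) * w s j))\<^sup>2) = 1"
    using parseval[of n "\<lambda>s i. cnj (u s i)" "\<lambda>s. w s j"] by simp
qed

text \<open>The function \<open>tr (exp(\<i> r a) exp(\<i> (t - r) b))\<close> of \<open>r\<close>
  interpolates between the two sums. Besides overlaps and matrix elements of \<open>a - b\<close>,
  its derivative contains only unimodular factors depending on \<open>i\<close> or on
  \<open>j\<close>, which is why \<open>bound\<close> is demanded for all such
  \<open>\<alpha>\<close> and \<open>\<beta>\<close>.\<close>

lemma trace_iexp_Lipschitz: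
  assumes u: "spectral_data n a l u" and w: "spectral_data n b m w"
    and bound: "\<And>\<alpha> \<beta> :: nat \<Rightarrow> complex. (\<And>i. cmod (\<alpha> i) = 1) \<Longrightarrow> (\<And>j. cmod (\<beta> j) = 1) \<Longrightarrow>
      cmod (\<Sum>i<n. \<Sum>j<n. cnj (\<Sum>s<n. cnj (u s i) * w s j) * (\<alpha> i * \<beta> j) *
         (\<Sum>s<n. \<Sum>t<n. (a s t - b s t) * (cnj (u s i) * w t j))) \<le> K"
  shows "cmod ((\<Sum>i<n. cis (t * l i)) - (\<Sum>j<n. cis (t * m j))) \<le> K * \<bar>t\<bar>"
proof -
  define c where "c i j = (\<Sum>s<n. cnj (u s i) * w s j)" for i j
  \<comment> \<open>This is the interpolating trace in the two eigenbases: the exponent is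
    \<open>\<i> * (r * l i + (t - r) * m j)\<close> and the weight is the squared overlap.\<close>
  define \<phi> where "\<phi> r = (\<Sum>i<n. \<Sum>j<n. cnj (c i j) * c i j * exp (of_real r * (\<i> * (of_real (l i) - of_real (m j))) + \<i> * of_real (t * m j)))"
    for r :: real
  define \<phi>' where "\<phi>' r = (\<Sum>i<n. \<Sum>j<n. cnj (c i j) * c i j * (\<i> * (of_real (l i) - of_real (m j)) *
      exp (of_real r * (\<i> * (of_real (l i) - of_real (m j))) + \<i> * of_real (t * m j))))"
    for r :: real
  have der: "(\<phi> has_vector_derivative \<phi>' r) (at r within UNIV)" for r
  proof -
    have "((\<lambda>z. exp (z * d + e)) has_field_derivative d * exp (of_real r * d + e)) (at (of_real r))" for d e :: complex
      by (auto intro!: derivative_eq_intros)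
    from has_vector_derivative_real_field[OF this]
    have "((\<lambda>x. exp (of_real x * d + e)) has_vector_derivative d * exp (of_real r * d + e)) (at r within UNIV)" for d e :: complex .
    then show ?thesis
      unfolding \<phi>_def \<phi>'_def by (intro has_vector_derivative_sum has_vector_derivative_mult_right)
  qed
  have "cmod (\<phi>' r) \<le> K" for r
  proof -
    have "\<phi>' r = \<i> * (\<Sum>i<n. \<Sum>j<n. cnj (c i j) * (cis (r * l i) * cis ((t - r) * m j)) *
        ((of_real (l i) - of_real (m j)) * c i j))"
      unfolding \<phi>'_def sum_distrib_left
    proof (intro sum.cong refl)
      fix i j
      have "exp (of_real r * (\<i> * (of_real (l i) - of_real (m j))) + \<i> * of_real (t * m j))
        = cis (r * l i) * cis ((t - r) * m j)"
        unfolding cis_mult unfolding cis_conv_exp by (simp add: algebra_simps)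
      then show "cnj (c i j) * c i j * (\<i> * (of_real (l i) - of_real (m j)) *
          exp (of_real r * (\<i> * (of_real (l i) - of_real (m j))) + \<i> * of_real (t * m j)))
        = \<i> * (cnj (c i j) * (cis (r * l i) * cis ((t - r) * m j)) * ((of_real (l i) - of_real (m j)) * c i j))"
        by (simp only: mult_ac)
    qed
    also have "(\<Sum>i<n. \<Sum>j<n. cnj (c i j) * (cis (r * l i) * cis ((t - r) * m j)) * ((of_real (l i) - of_real (m j)) * c i j))
      = (\<Sum>i<n. \<Sum>j<n. cnj (c i j) * (cis (r * l i) * cis ((t - r) * m j)) *
        (\<Sum>s<n. \<Sum>t<n. (a s t - b s t) * (cnj (u s i) * w t j)))"
      by (intro sum.cong refl) (simp add: overlap_eigenvalue_difference[OF u w] c_def)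
    finally show ?thesis
      using bound[of "\<lambda>i. cis (r * l i)" "\<lambda>j. cis ((t - r) * m j)"] by (simp add: norm_mult c_def)
  qed
  then have "cmod (\<phi> t - \<phi> 0) \<le> K * norm (t - 0)"
    using der unfolding has_vector_derivative_def
    by (intro differentiable_bound[of UNIV \<phi> "\<lambda>r h. h *\<^sub>R \<phi>' r"] onorm_le)
       (auto simp: mult.commute[of K] intro: mult_left_mono)
  \<comment> \<open>At \<open>r = t\<close> the exponent no longer involves \<open>m j\<close>, so
    the squared overlaps can be summed over \<open>j\<close> to 1. At \<open>r = 0\<close> the roles
    of \<open>i\<close> and \<open>j\<close> are exchanged.\<close>
  moreover have "\<phi> t = (\<Sum>i<n. cis (t * l i))"
  proof -
    have "\<phi> t = (\<Sum>i<n. \<Sum>j<n. cis (t * l i) * of_real ((cmod (c i j))\<^sup>2))"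
      unfolding \<phi>_def complex_norm_square
      by (intro sum.cong refl) (simp add: cis_conv_exp algebra_simps)
    also have "\<dots> = (\<Sum>i<n. cis (t * l i))"
      by (intro sum.cong refl)
         (simp add: overlap_sums[OF u w] c_def flip: of_real_power of_real_sum sum_distrib_left)
    finally show ?thesis .
  qed
  moreover have "\<phi> 0 = (\<Sum>j<n. cis (t * m j))"
  proof -
    have "\<phi> 0 = (\<Sum>j<n. \<Sum>i<n. cis (t * m j) * of_real ((cmod (c i j))\<^sup>2))"
      unfolding \<phi>_def complex_norm_square
      by (subst sum.swap, intro sum.cong refl) (simp add: cis_conv_exp algebra_simps)
    also have "\<dots> = (\<Sum>j<n. cis (t * m j))"
      by (intro sum.cong refl)
         (simp add: overlap_sums[OF u w] c_def flip: of_real_power of_real_sum sum_distrib_left)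
    finally show ?thesis .
  qed
  ultimately show ?thesis by simp
qed

text \<open>With indices from 0 the flip sends row \<open>s\<close> to row \<open>n - 1 - s\<close>,
  so these are the entries of the flipped Toeplitz matrix. They depend only on
  \<open>s + t\<close>.\<close>

abbreviation hankel :: "(real \<Rightarrow> complex) \<Rightarrow> nat \<Rightarrow> nat \<Rightarrow> nat \<Rightarrow> complex"
  where "hankel f n s t \<equiv> fourier_coeff f (int n - 1 - int s - int t)"

text \<open>The integral formula for Fourier coefficients turns the expression bounded in
  \<open>trace_iexp_Lipschitz\<close> into an integral of \<open>f - g\<close> against a function of
  modulus at most \<open>n\<close>. Averaging over the \<open>n\<close> eigenvalues will cancel this
  factor, so the estimate is uniform in \<open>n\<close>.\<close>

lemma hankel_trace_iexp_Lipschitz: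
  assumes f: "integrable leb f" and g: "integrable leb g"
    and u: "spectral_data n (hankel f n) l u" and w: "spectral_data n (hankel g n) m w"
  shows "cmod ((\<Sum>i<n. cis (t * l i)) - (\<Sum>j<n. cis (t * m j)))
    \<le> real n / (2 * pi) * (LINT \<theta>|leb. cmod (f \<theta> - g \<theta>)) * \<bar>t\<bar>"
proof (rule trace_iexp_Lipschitz[OF u w])
  fix \<alpha> \<beta> :: "nat \<Rightarrow> complex"
  assume \<alpha>: "\<And>i. cmod (\<alpha> i) = 1" and \<beta>: "\<And>j. cmod (\<beta> j) = 1"
  define c where "c i j = (\<Sum>s<n. cnj (u s i) * w s j)" for i j
  define h where "h \<theta> = f \<theta> - g \<theta>" for \<theta>
  have h: "integrable leb h" using f g by (simp add: h_def[abs_def])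
  define k where "k s t = int n - 1 - int s - int t" for s t
  have hc: "integrable leb (\<lambda>\<theta>. h \<theta> * cis (- (of_int j * \<theta>)))" for j
    using integrable_leb_times_cis[OF h, of "- of_int j"] by simp
  have "fourier_coeff f j - fourier_coeff g j
     = of_real (1 / (2 * pi)) * (LINT \<theta>|leb. h \<theta> * cis (- (of_int j * \<theta>)))" for j
  proof -
    have "integrable leb (\<lambda>\<theta>. f \<theta> * cis (- (of_int j * \<theta>)))" "integrable leb (\<lambda>\<theta>. g \<theta> * cis (- (of_int j * \<theta>)))" for j
      using integrable_leb_times_cis[OF f, of "- of_int j"] integrable_leb_times_cis[OF g, of "- of_int j"] by simp_all
    then show ?thesis
      unfolding fourier_coeff_leb h_def left_diff_distrib right_diff_distrib[symmetric]
      by (subst Bochner_Integration.integral_diff) simp_all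
  qed
  then have diff: "hankel f n s t - hankel g n s t
     = of_real (1 / (2 * pi)) * (LINT \<theta>|leb. h \<theta> * cis (- (of_int (k s t) * \<theta>)))" for s t
    by (simp add: k_def)
  \<comment> \<open>For fixed \<open>\<theta>\<close> the exponential splits into a factor in
    \<open>s\<close> and a factor in \<open>t\<close>. Hence \<open>P\<close> is the overlap form
    evaluated at the coordinates of the vector with entries
    \<open>cis (s * \<theta>)\<close>.\<close>
  define P where "P \<theta> = (\<Sum>i<n. \<Sum>j<n. cnj (c i j) *
      ((\<alpha> i * (\<Sum>s<n. cnj (u s i) * cis (s * \<theta>))) * (\<beta> j * (\<Sum>t<n. w t j * cis (t * \<theta>)))))" for \<theta> :: real
  \<comment> \<open>That vector has squared norm \<open>n\<close>, so both square roots in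
    \<open>overlap_form_bound\<close> equal \<open>sqrt n\<close>.\<close>
  have Pb: "cmod (P \<theta>) \<le> n" for \<theta>
  proof -
    have "(\<Sum>i<n. cnj (u s i) * u t i) = (if s = t then 1 else 0)" if "s < n" "t < n" for s t
      using spectral_dataD(3)[OF u that(2,1)] by (auto simp: mult.commute)
    then have 1: "(\<Sum>i<n. (cmod (\<Sum>s<n. cnj (u s i) * cis (s * \<theta>)))\<^sup>2) = n"
      by (subst parseval) simp_all
    have 2: "(\<Sum>j<n. (cmod (\<Sum>t<n. w t j * cis (t * \<theta>)))\<^sup>2) = n"
      by (subst parseval) (use spectral_dataD(3)[OF w] in simp_all)
    show ?thesis
      unfolding P_def c_def
      by (rule order_trans[OF overlap_form_bound[OF u w]]) (simp add: norm_mult \<alpha> \<beta> 1 2)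
  qed
  have eq: "(\<Sum>i<n. \<Sum>j<n. cnj (c i j) * (\<alpha> i * \<beta> j) *
         (\<Sum>s<n. \<Sum>t<n. (hankel f n s t - hankel g n s t) * (cnj (u s i) * w t j)))
    = of_real (1 / (2 * pi)) * (LINT \<theta>|leb. h \<theta> * (cis (- (real n - 1) * \<theta>) * P \<theta>))"
  proof -
    have "(\<Sum>i<n. \<Sum>j<n. cnj (c i j) * (\<alpha> i * \<beta> j) *
         (\<Sum>s<n. \<Sum>t<n. (hankel f n s t - hankel g n s t) * (cnj (u s i) * w t j)))
      = of_real (1 / (2 * pi)) * (\<Sum>i<n. \<Sum>j<n. \<Sum>s<n. \<Sum>t<n. 
          (LINT \<theta>|leb. h \<theta> * cis (- (of_int (k s t) * \<theta>))) * (cnj (c i j) * (\<alpha> i * \<beta> j) * (cnj (u s i) * w t j)))"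
      unfolding diff sum_distrib_left by (intro sum.cong refl) (simp only: mult_ac)
    also have "(\<Sum>i<n. \<Sum>j<n. \<Sum>s<n. \<Sum>t<n. 
          (LINT \<theta>|leb. h \<theta> * cis (- (of_int (k s t) * \<theta>))) * (cnj (c i j) * (\<alpha> i * \<beta> j) * (cnj (u s i) * w t j)))
      = (LINT \<theta>|leb. (\<Sum>i<n. \<Sum>j<n. \<Sum>s<n. \<Sum>t<n. 
          h \<theta> * cis (- (of_int (k s t) * \<theta>)) * (cnj (c i j) * (\<alpha> i * \<beta> j) * (cnj (u s i) * w t j))))"
      by (rule has_bochner_integral_integral_eq[symmetric],
          intro has_bochner_integral_sum has_bochner_integral_mult_left has_bochner_integral_integrable hc)
    also have "(\<lambda>\<theta>. \<Sum>i<n. \<Sum>j<n. \<Sum>s<n. \<Sum>t<n. 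
          h \<theta> * cis (- (of_int (k s t) * \<theta>)) * (cnj (c i j) * (\<alpha> i * \<beta> j) * (cnj (u s i) * w t j)))
      = (\<lambda>\<theta>. h \<theta> * (cis (- (real n - 1) * \<theta>) * P \<theta>))"
    proof
      fix \<theta>
      have cis: "cis (- (of_int (k s t) * \<theta>)) = cis (- (real n - 1) * \<theta>) * (cis (s * \<theta>) * cis (t * \<theta>))" for s t
        by (simp add: cis_mult k_def algebra_simps)
      show "(\<Sum>i<n. \<Sum>j<n. \<Sum>s<n. \<Sum>t<n. 
          h \<theta> * cis (- (of_int (k s t) * \<theta>)) * (cnj (c i j) * (\<alpha> i * \<beta> j) * (cnj (u s i) * w t j)))
        = h \<theta> * (cis (- (real n - 1) * \<theta>) * P \<theta>)"
        unfolding P_def cis sum_distrib_left[of "h \<theta>"] sum_distrib_left[of "cis (- (real n - 1) * \<theta>)"]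
      proof (intro sum.cong refl)
        fix i j
        have "(\<Sum>s<n. \<Sum>t<n. h \<theta> * (cis (- (real n - 1) * \<theta>) * (cis (s * \<theta>) * cis (t * \<theta>)))
            * (cnj (c i j) * (\<alpha> i * \<beta> j) * (cnj (u s i) * w t j)))
          = h \<theta> * cis (- (real n - 1) * \<theta>) * cnj (c i j) * \<alpha> i * \<beta> j *
            (\<Sum>s<n. \<Sum>t<n. (cnj (u s i) * cis (s * \<theta>)) * (w t j * cis (t * \<theta>)))"
          unfolding sum_distrib_left by (intro sum.cong refl) (simp only: mult_ac)
        also note sum_product[symmetric]
        finally show "(\<Sum>s<n. \<Sum>t<n. h \<theta> * (cis (- (real n - 1) * \<theta>) * (cis (s * \<theta>) * cis (t * \<theta>)))
            * (cnj (c i j) * (\<alpha> i * \<beta> j) * (cnj (u s i) * w t j)))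
          = h \<theta> * (cis (- (real n - 1) * \<theta>) * (cnj (c i j) *
             ((\<alpha> i * (\<Sum>s<n. cnj (u s i) * cis (s * \<theta>))) * (\<beta> j * (\<Sum>t<n. w t j * cis (t * \<theta>))))))"
          by (simp only: mult_ac)
      qed
    qed
    finally show ?thesis .
  qed
  have "cmod (LINT \<theta>|leb. h \<theta> * (cis (- (real n - 1) * \<theta>) * P \<theta>)) \<le> (LINT \<theta>|leb. cmod (h \<theta>) * n)"
  proof (rule order_trans[OF Bochner_Integration.integral_norm_bound], rule Bochner_Integration.integral_mono)
    show "integrable leb (\<lambda>\<theta>. cmod (h \<theta> * (cis (- (real n - 1) * \<theta>) * P \<theta>)))"
      using Pb by (intro integrable_norm integrable_leb_times_bounded[OF h, where B=n])
        (auto simp: P_def norm_mult intro!: continuous_intros)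
    show "integrable leb (\<lambda>\<theta>. cmod (h \<theta>) * n)" using h by simp
  qed (auto simp: norm_mult intro!: mult_left_mono Pb)
  also have "\<dots> = n * (LINT \<theta>|leb. cmod (h \<theta>))" by simp
  finally have le: "cmod (LINT \<theta>|leb. h \<theta> * (cis (- (real n - 1) * \<theta>) * P \<theta>)) \<le> n * (LINT \<theta>|leb. cmod (h \<theta>))" .
  have "cmod (complex_of_real (1 / (2 * pi)) * z) \<le> real n / (2 * pi) * x" if "cmod z \<le> n * x" for z and x :: real
    using that by (simp add: norm_mult norm_divide field_simps)
  from this[OF le]
  show "cmod (\<Sum>i<n. \<Sum>j<n. cnj (\<Sum>s<n. cnj (u s i) * w s j) * (\<alpha> i * \<beta> j) *
         (\<Sum>s<n. \<Sum>t<n. (hankel f n s t - hankel g n s t) * (cnj (u s i) * w t j)))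
     \<le> real n / (2 * pi) * (LINT \<theta>|leb. cmod (f \<theta> - g \<theta>))"
    unfolding c_def[symmetric] eq h_def .
qed

subsection \<open>Trigonometric polynomials\<close>

primrec mpow :: "nat \<Rightarrow> (nat \<Rightarrow> nat \<Rightarrow> complex) \<Rightarrow> nat \<Rightarrow> nat \<Rightarrow> nat \<Rightarrow> complex" where
  "mpow n a 0 s t = (if s = t then 1 else 0)"
| "mpow n a (Suc m) s t = (\<Sum>x<n. a s x * mpow n a m x t)"

lemma mpow_spectral:
  assumes sd: "spectral_data n a l u" and t: "t < n"
  shows "s < n \<Longrightarrow> mpow n a m s t = (\<Sum>j<n. of_real (l j ^ m) * (u s j * cnj (u t j)))"
proof (induction m arbitrary: s)
  case 0
  then show ?case using sd t unfolding spectral_data_def by simp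
next
  case (Suc m)
  have "mpow n a (Suc m) s t = (\<Sum>x<n. \<Sum>j<n. of_real (l j ^ m) * cnj (u t j) * (a s x * u x j))"
    using Suc by (simp add: sum_distrib_left mult_ac)
  also have "\<dots> = (\<Sum>j<n. of_real (l j ^ m) * cnj (u t j) * (\<Sum>x<n. a s x * u x j))"
    unfolding sum_distrib_left by (rule sum.swap)
  also have "\<dots> = (\<Sum>j<n. of_real (l j ^ Suc m) * (u s j * cnj (u t j)))"
    using sd Suc.prems unfolding spectral_data_def by (intro sum.cong refl) simp
  finally show ?case .
qed

lemma trace_mpow:
  assumes sd: "spectral_data n a l u"
  shows "(\<Sum>s<n. mpow n a m s s) = (\<Sum>j<n. of_real (l j ^ m))"
proof -
  have "(\<Sum>s<n. mpow n a m s s) = (\<Sum>s<n. \<Sum>j<n. of_real (l j ^ m) * (cnj (u s j) * u s j))"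
    by (intro sum.cong refl) (simp add: mpow_spectral[OF sd] mult.commute)
  also have "\<dots> = (\<Sum>j<n. of_real (l j ^ m) * (\<Sum>s<n. cnj (u s j) * u s j))"
    unfolding sum_distrib_left by (rule sum.swap)
  also have "\<dots> = (\<Sum>j<n. of_real (l j ^ m))"
    using sd unfolding spectral_data_def by (intro sum.cong refl) simp
  finally show ?thesis .
qed

text \<open>The largest absolute row sum is a submultiplicative matrix norm. For Hankel matrices of
  a trigonometric polynomial \<open>M\<close> can be taken independent of \<open>n\<close>.\<close>

lemma mpow_row_sum_bound:
  assumes M: "\<And>s. s < n \<Longrightarrow> (\<Sum>x<n. cmod (a s x)) \<le> M"
  shows "s < n \<Longrightarrow> (\<Sum>t<n. cmod (mpow n a m s t)) \<le> M ^ m"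
proof (induction m arbitrary: s)
  case 0
  have "(\<Sum>t<n. cmod (if s = t then 1 else 0)) = (\<Sum>t<n. if t = s then 1 else 0)"
    by (intro sum.cong) auto
  then show ?case using 0 by simp
next
  case (Suc m)
  have M0: "0 \<le> M" using M[OF Suc.prems] by (meson norm_ge_zero order_trans sum_nonneg)
  have "(\<Sum>t<n. cmod (mpow n a (Suc m) s t)) \<le> (\<Sum>t<n. \<Sum>x<n. cmod (a s x) * cmod (mpow n a m x t))"
    by (intro sum_mono) (simp add: sum_norm_le norm_mult)
  also have "\<dots> = (\<Sum>x<n. cmod (a s x) * (\<Sum>t<n. cmod (mpow n a m x t)))"
    unfolding sum_distrib_left by (rule sum.swap)
  also have "\<dots> \<le> (\<Sum>x<n. cmod (a s x) * M ^ m)"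
    using Suc.IH by (intro sum_mono mult_left_mono) auto
  also have "\<dots> \<le> M * M ^ m"
    unfolding sum_distrib_right[symmetric] using M[OF Suc.prems] M0 by (intro mult_right_mono) auto
  finally show ?case by simp
qed

lemma mpow_entry_bound:
  assumes "\<And>s. s < n \<Longrightarrow> (\<Sum>x<n. cmod (a s x)) \<le> M" "s < n" "t < n"
  shows "cmod (mpow n a m s t) \<le> M ^ m"
  using mpow_row_sum_bound[OF assms(1,2), where m=m] member_le_sum[of t "{..<n}" "\<lambda>t. cmod (mpow n a m s t)"] assms(3)
  by force

text \<open>One factor links \<open>s\<close> only to indices within distance \<open>r\<close> of
  its reflection \<open>\<rho> s\<close>. As \<open>\<rho>\<close> is an isometry, these deviations
  add up to at most \<open>m * r\<close> after \<open>m\<close> factors.\<close>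

lemma mpow_hankel_band:
  fixes d :: "int \<Rightarrow> complex" and r n :: nat
  assumes band: "\<And>k. \<bar>k\<bar> > int r \<Longrightarrow> d k = 0"
  defines "\<rho> \<equiv> \<lambda>x::int. int n - 1 - x"
  shows "\<bar>int s - (\<rho> ^^ m) (int t)\<bar> > int (m * r) \<Longrightarrow> mpow n (\<lambda>s t. d (int n - 1 - int s - int t)) m s t = 0"
proof (induction m arbitrary: s)
  case 0
  then show ?case by auto
next
  case (Suc m)
  have "d (int n - 1 - int s - int x) * mpow n (\<lambda>s t. d (int n - 1 - int s - int t)) m x t = 0" for x
  proof (cases "\<bar>int n - 1 - int s - int x\<bar> > int r")
    case False
    then have "\<bar>int x - (\<rho> ^^ m) (int t)\<bar> > int (m * r)"
      using Suc.prems by (auto simp: \<rho>_def algebra_simps)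
    then show ?thesis using Suc.IH by simp
  qed (simp add: band)
  then show ?case by simp
qed

lemma flip_funpow: "((\<lambda>x::int. c - x) ^^ m) y = (if even m then y else c - y)"
  by (induction m) auto

section \<open>Action of Hankel matrices of trigonometric polynomials on exponentials\<close>

definition trigpoly :: "nat \<Rightarrow> (int \<Rightarrow> real) \<Rightarrow> real \<Rightarrow> complex" where
  "trigpoly r c \<theta> = (\<Sum>k=-int r..int r. of_real (c k) * cis (of_int k * \<theta>))"

lemma trigpoly_uminus: "trigpoly r c (- \<theta>) = cnj (trigpoly r c \<theta>)"
  by (simp add: trigpoly_def cis_cnj)

text \<open>Substituting \<open>k = n - 1 - s - t\<close> turns the sum into one over the
  frequencies of the polynomial. The window for \<open>s\<close> is narrower by \<open>r\<close> at
  both ends, so every \<open>t\<close> that occurs lies where \<open>x\<close> is known to be an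
  exponential.\<close>

lemma hankel_step:
  fixes c :: "int \<Rightarrow> real" and x :: "nat \<Rightarrow> complex"
  assumes c: "\<And>k. \<bar>k\<bar> > int r \<Longrightarrow> c k = 0"
    and x: "\<And>t. int m \<le> int t \<Longrightarrow> int t < int n - int m \<Longrightarrow> x t = \<alpha> * cis (of_int (int t) * \<phi>)"
    and s: "int (m + r) \<le> int s" "int s < int n - int (m + r)"
  shows "(\<Sum>t<n. of_real (c (int n - 1 - int s - int t)) * x t)
    = \<alpha> * cis (of_int (int n - 1) * \<phi>) * trigpoly r c (- \<phi>) * cis (of_int (int s) * (- \<phi>))"
proof -
  define K where "K = {-int r..int r}"
  \<comment> \<open>This is the column belonging to frequency \<open>k\<close>. For \<open>k\<close>
    in \<open>K\<close> the argument of \<open>nat\<close> is nonnegative by the range of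
    \<open>s\<close>.\<close>
  define g where "g k = nat (int n - 1 - int s - k)" for k
  have "(\<Sum>t<n. of_real (c (int n - 1 - int s - int t)) * x t)
      = (\<Sum>t\<in>g ` K. of_real (c (int n - 1 - int s - int t)) * x t)"
  proof (rule sum.mono_neutral_right)
    show "g ` K \<subseteq> {..<n}" using s by (auto simp: g_def K_def)
    show "\<forall>t\<in>{..<n} - g ` K. of_real (c (int n - 1 - int s - int t)) * x t = 0"
    proof
      fix t assume t: "t \<in> {..<n} - g ` K"
      have "int n - 1 - int s - int t \<notin> K"
      proof
        assume "int n - 1 - int s - int t \<in> K"
        then have "g (int n - 1 - int s - int t) \<in> g ` K" by blast
        then show False using t by (simp add: g_def)
      qed
      then show "of_real (c (int n - 1 - int s - int t)) * x t = 0"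
        by (auto simp: K_def intro!: c)
    qed
  qed auto
  also have "\<dots> = (\<Sum>k\<in>K. of_real (c (int n - 1 - int s - int (g k))) * x (g k))"
    using s by (intro sum.reindex_cong[of g]) (auto simp: inj_on_def g_def K_def)
  also have "\<dots> = (\<Sum>k\<in>K. of_real (c k) * (\<alpha> * cis (of_int (int n - 1 - int s - k) * \<phi>)))"
  proof (intro sum.cong refl)
    fix k assume "k \<in> K"
    then have k: "int (g k) = int n - 1 - int s - k" "int m \<le> int (g k)" "int (g k) < int n - int m"
      using s by (auto simp: g_def K_def)
    then have "int n - 1 - int s - int (g k) = k" by simp
    then show "of_real (c (int n - 1 - int s - int (g k))) * x (g k)
       = of_real (c k) * (\<alpha> * cis (of_int (int n - 1 - int s - k) * \<phi>))"
      unfolding x[OF k(2,3)] k(1) by simp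
  qed
  also have "\<dots> = \<alpha> * cis (of_int (int n - 1) * \<phi>) * trigpoly r c (- \<phi>) * cis (of_int (int s) * (- \<phi>))"
  proof -
    have "cis (of_int (int n - 1 - int s - k) * \<phi>)
      = cis (of_int (int n - 1) * \<phi>) * cis (of_int k * (- \<phi>)) * cis (of_int (int s) * (- \<phi>))" for k
      by (simp add: cis_mult algebra_simps)
    then show ?thesis
      unfolding trigpoly_def K_def[symmetric] sum_distrib_left sum_distrib_right
      by (intro sum.cong refl) (simp only: mult_ac)
  qed
  finally show ?thesis .
qed

text \<open>Each induction step applies \<open>hankel_step\<close> twice. The first application
  reverses the frequency and the second restores it; the phases
  \<open>cis ((n - 1) * \<theta>)\<close> cancel, and the two polynomial factors are conjugate
  because the coefficients are real. Each application costs \<open>r\<close> indices at both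
  ends.\<close>

lemma mpow_hankel_exponential:
  fixes c :: "int \<Rightarrow> real" and n :: nat
  assumes c: "\<And>k. \<bar>k\<bar> > int r \<Longrightarrow> c k = 0"
  defines "a \<equiv> \<lambda>s t. complex_of_real (c (int n - 1 - int s - int t))"
  shows "int (2 * k * r) \<le> int s \<Longrightarrow> int s < int n - int (2 * k * r) \<Longrightarrow>
    (\<Sum>t<n. mpow n a (2 * k) s t * cis (of_int (int t) * \<theta>))
      = of_real (cmod (trigpoly r c \<theta>) ^ (2 * k)) * cis (of_int (int s) * \<theta>)"
proof (induction k arbitrary: s)
  case 0
  have "(\<Sum>t<n. mpow n a (2 * 0) s t * cis (of_int (int t) * \<theta>))
    = (\<Sum>t<n. if t = s then cis (of_int (int t) * \<theta>) else 0)"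
    by (intro sum.cong) auto
  then show ?case using 0 by simp
next
  case (Suc k)
  define x where "x m s = (\<Sum>t<n. mpow n a m s t * cis (of_int (int t) * \<theta>))" for m s
  have xS: "x (Suc m) s = (\<Sum>t<n. a s t * x m t)" for m s
  proof -
    have "x (Suc m) s = (\<Sum>t<n. \<Sum>y<n. a s y * (mpow n a m y t * cis (of_int (int t) * \<theta>)))"
      unfolding x_def mpow.simps sum_distrib_right by (simp only: mult.assoc)
    also have "\<dots> = (\<Sum>y<n. a s y * x m y)"
      unfolding x_def sum_distrib_left by (rule sum.swap)
    finally show ?thesis .
  qed
  define \<beta> where "\<beta> = complex_of_real (cmod (trigpoly r c \<theta>) ^ (2 * k))"
  have 1: "x (Suc (2 * k)) t = \<beta> * cis (of_int (int n - 1) * \<theta>) * trigpoly r c (- \<theta>) * cis (of_int (int t) * (- \<theta>))"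
    if "int (2 * k * r + r) \<le> int t" "int t < int n - int (2 * k * r + r)" for t
    unfolding xS a_def
    by (rule hankel_step[of r c "2 * k * r"]) (use that c Suc.IH in \<open>auto simp: x_def \<beta>_def\<close>)
  have "x (Suc (Suc (2 * k))) s = \<beta> * cis (of_int (int n - 1) * \<theta>) * trigpoly r c (- \<theta>)
      * cis (of_int (int n - 1) * - \<theta>) * trigpoly r c (- (- \<theta>)) * cis (of_int (int s) * (- (- \<theta>)))"
    unfolding xS[of "Suc (2 * k)"] a_def
    by (rule hankel_step[of r c "2 * k * r + r"]) (use c Suc.prems 1 in \<open>auto simp: algebra_simps\<close>)
  also have "\<dots> = \<beta> * (cis (of_int (int n - 1) * \<theta>) * cis (of_int (int n - 1) * - \<theta>))
      * (trigpoly r c \<theta> * cnj (trigpoly r c \<theta>)) * cis (of_int (int s) * \<theta>)"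
    unfolding trigpoly_uminus by (simp add: mult_ac)
  also have "cis (of_int (int n - 1) * \<theta>) * cis (of_int (int n - 1) * - \<theta>) = 1"
    by (simp add: cis_mult)
  also have "trigpoly r c \<theta> * cnj (trigpoly r c \<theta>) = of_real ((cmod (trigpoly r c \<theta>))\<^sup>2)"
    by (rule complex_norm_square[symmetric])
  finally show ?case by (simp add: x_def \<beta>_def power_add power2_eq_square mult_ac)
qed

section \<open>Orthogonality of exponentials and Fourier coefficients of trigonometric
  polynomials\<close>

lemma finite_measure_leb: "finite_measure leb"
  by (rule finite_measure_lebesgue_on) simp

lemma integrable_leb_continuous_bounded:
  fixes g :: "real \<Rightarrow> complex"
  assumes "continuous_on UNIV g" "\<And>x. norm (g x) \<le> B"
  shows "integrable leb g"
  using integrable_leb_times_bounded[of "\<lambda>_. 1" g B] assms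
    finite_measure.integrable_const[OF finite_measure_leb] by simp

lemma integrable_leb_cis: "integrable leb (\<lambda>\<theta>. cis (c * \<theta>))"
  by (rule integrable_leb_continuous_bounded[where B=1]) (auto intro!: continuous_intros)

lemma LINT_leb_cis:
  "(LINT \<theta>|leb. cis (of_int k * \<theta>)) = (if k = 0 then of_real (2 * pi) else 0)"
proof (cases "k = 0")
  case True
  then show ?thesis by (simp add: measure_restrict_space scaleR_conv_of_real)
next
  case False
  have "((\<lambda>z. exp (\<i> * of_int k * z) / (\<i> * of_int k)) has_field_derivative exp (\<i> * of_int k * of_real x)) (at (of_real x))" for x
    using False by (auto intro!: derivative_eq_intros)
  from has_vector_derivative_real_field[OF this]
  have "((\<lambda>x. exp (\<i> * of_int k * of_real x) / (\<i> * of_int k)) has_vector_derivative exp (\<i> * of_int k * of_real x)) (at x within {-pi..pi})" for x .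
  then have "((\<lambda>x. exp (\<i> * of_int k * of_real x)) has_integral
     (exp (\<i> * of_int k * of_real pi) / (\<i> * of_int k) - exp (\<i> * of_int k * of_real (-pi)) / (\<i> * of_int k))) {-pi..pi}"
    by (intro fundamental_theorem_of_calculus) auto
  moreover have "exp (\<i> * of_int k * of_real pi) = exp (\<i> * of_int k * of_real (-pi))"
    by (rule exp_eq[THEN iffD2]) (auto intro!: exI[of _ k] simp: algebra_simps)
  ultimately have "((\<lambda>x. cis (of_int k * x)) has_integral 0) {-pi..pi}"
    by (simp add: cis_conv_exp mult_ac)
  then have "integral {-pi..pi} (\<lambda>x. cis (of_int k * x)) = 0" by (rule integral_unique)
  then show ?thesis
    using lebesgue_integral_eq_integral[OF integrable_leb_cis[of "of_int k"]] False by simp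
qed

lemma continuous_on_trigpoly: "continuous_on UNIV (trigpoly r c)"
  unfolding trigpoly_def[abs_def] by (intro continuous_intros)

lemma cmod_trigpoly_le: "cmod (trigpoly r c \<theta>) \<le> (\<Sum>k=-int r..int r. \<bar>c k\<bar>)"
  unfolding trigpoly_def by (rule sum_norm_le) (simp add: norm_mult)

lemma integrable_trigpoly: "integrable leb (trigpoly r c)"
  by (rule integrable_leb_continuous_bounded[OF continuous_on_trigpoly cmod_trigpoly_le])

lemma fourier_coeff_trigpoly:
  "fourier_coeff (trigpoly r c) k = (if \<bar>k\<bar> \<le> int r then of_real (c k) else 0)"
proof -
  have "(LINT \<theta>|leb. trigpoly r c \<theta> * cis (- (of_int k * \<theta>)))
    = (LINT \<theta>|leb. (\<Sum>j=-int r..int r. of_real (c j) * cis (of_int (j - k) * \<theta>)))"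
    unfolding trigpoly_def sum_distrib_right mult.assoc cis_mult by (simp add: algebra_simps)
  also have "\<dots> = (\<Sum>j=-int r..int r. of_real (c j) * (LINT \<theta>|leb. cis (of_int (j - k) * \<theta>)))"
    by (rule has_bochner_integral_integral_eq, intro has_bochner_integral_sum has_bochner_integral_mult_right
        has_bochner_integral_integrable integrable_leb_cis)
  also have "\<dots> = (\<Sum>j=-int r..int r. if j = k then of_real (c j) * of_real (2 * pi) else 0)"
    unfolding LINT_leb_cis by (intro sum.cong) auto
  also have "\<dots> = (if \<bar>k\<bar> \<le> int r then of_real (c k) * of_real (2 * pi) else 0)"
    by auto
  finally show ?thesis unfolding fourier_coeff_leb by simp
qed

section \<open>Asymptotics of the moments\<close>

lemma hankel_row_sum:
  fixes c :: "int \<Rightarrow> real" and n :: nat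
  assumes c: "\<And>k. \<bar>k\<bar> > int r \<Longrightarrow> c k = 0"
  shows "(\<Sum>x<n. cmod (of_real (c (int n - 1 - int s - int x)))) \<le> (\<Sum>k=-int r..int r. \<bar>c k\<bar>)"
proof -
  define g where "g x = int n - 1 - int s - int x" for x
  have "(\<Sum>x<n. cmod (of_real (c (int n - 1 - int s - int x)))) = (\<Sum>k\<in>g ` {..<n}. \<bar>c k\<bar>)"
    by (subst sum.reindex) (auto simp: g_def inj_on_def)
  also have "\<dots> \<le> (\<Sum>k\<in>g ` {..<n} \<union> {-int r..int r}. \<bar>c k\<bar>)"
    by (rule sum_mono2) auto
  also have "\<dots> = (\<Sum>k=-int r..int r. \<bar>c k\<bar>)"
    by (rule sum.mono_neutral_right) (auto intro!: c)
  finally show ?thesis .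
qed

text \<open>The row \<open>s\<close> of the power is a list of Fourier coefficients. By
  \<open>mpow_hankel_exponential\<close> the function they generate is \<open>|q|\<close> to the
  power \<open>2 * k\<close> times \<open>cis (s * \<theta>)\<close>, so the diagonal entry is the
  mean of that power.\<close>

lemma mpow_hankel_diagonal:
  fixes c :: "int \<Rightarrow> real" and n :: nat
  assumes c: "\<And>k. \<bar>k\<bar> > int r \<Longrightarrow> c k = 0"
  defines "a \<equiv> \<lambda>s t. complex_of_real (c (int n - 1 - int s - int t))"
  assumes s: "int (2 * k * r) \<le> int s" "int s < int n - int (2 * k * r)"
  shows "mpow n a (2 * k) s s = of_real (1 / (2 * pi) * (LINT \<theta>|leb. cmod (trigpoly r c \<theta>) ^ (2 * k)))"
proof -
  have "(LINT \<theta>|leb. (\<Sum>t<n. mpow n a (2 * k) s t * cis (of_int (int t) * \<theta>)) * cis (- (of_int (int s) * \<theta>)))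
    = (LINT \<theta>|leb. (\<Sum>t<n. mpow n a (2 * k) s t * cis (of_int (int t - int s) * \<theta>)))"
    unfolding sum_distrib_right mult.assoc cis_mult by (simp add: algebra_simps)
  also have "\<dots> = (\<Sum>t<n. mpow n a (2 * k) s t * (LINT \<theta>|leb. cis (of_int (int t - int s) * \<theta>)))"
    by (rule has_bochner_integral_integral_eq, intro has_bochner_integral_sum has_bochner_integral_mult_right
        has_bochner_integral_integrable integrable_leb_cis)
  also have "\<dots> = (\<Sum>t<n. if t = s then mpow n a (2 * k) s t * of_real (2 * pi) else 0)"
    unfolding LINT_leb_cis by (intro sum.cong) auto
  also have "\<dots> = mpow n a (2 * k) s s * of_real (2 * pi)"
  proof -
    have "s < n" using s by linarith
    then show ?thesis by simp
  qed
  finally have 1: "(LINT \<theta>|leb. (\<Sum>t<n. mpow n a (2 * k) s t * cis (of_int (int t) * \<theta>)) * cis (- (of_int (int s) * \<theta>))) = \<dots>" .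
  have "(\<Sum>t<n. mpow n a (2 * k) s t * cis (of_int (int t) * \<theta>)) * cis (- (of_int (int s) * \<theta>))
    = of_real (cmod (trigpoly r c \<theta>) ^ (2 * k))" for \<theta>
    unfolding a_def using mpow_hankel_exponential[where c = c and r = r, OF c s] by (simp add: mult.assoc cis_mult)
  with 1 have "of_real (LINT \<theta>|leb. cmod (trigpoly r c \<theta>) ^ (2 * k)) = mpow n a (2 * k) s s * of_real (2 * pi)"
    by (simp only: integral_complex_of_real)
  then show ?thesis by (simp add: field_simps)
qed

lemma norm_sum_exceptional:
  fixes x :: "nat \<Rightarrow> complex"
  assumes B: "\<And>s. s < n \<Longrightarrow> cmod (x s) \<le> B" and 0: "\<And>s. s < n \<Longrightarrow> s \<notin> E \<Longrightarrow> x s = 0" and E: "finite E" "card E \<le> K"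
    and B0: "0 \<le> B"
  shows "cmod (\<Sum>s<n. x s) \<le> real K * B"
proof -
  have "(\<Sum>s<n. x s) = (\<Sum>s\<in>{..<n} \<inter> E. x s)"
    by (rule sum.mono_neutral_right) (auto intro: 0)
  also have "cmod \<dots> \<le> of_nat (card ({..<n} \<inter> E)) * B"
    by (rule sum_norm_bound) (auto intro: B)
  also have "\<dots> \<le> real K * B"
    using card_mono[OF E(1), of "{..<n} \<inter> E"] E(2) B0 by (intro mult_right_mono) auto
  finally show ?thesis .
qed

lemma tendsto_div_of_bounded_error:
  fixes x :: "nat \<Rightarrow> complex"
  assumes "\<And>n. cmod (x n - of_nat n * L) \<le> C"
  shows "(\<lambda>n. x n / of_nat n) \<longlonglongrightarrow> L"
proof -
  have "(\<lambda>n. x n / of_nat n - L) \<longlonglongrightarrow> 0"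
  proof (rule Lim_null_comparison)
    show "\<forall>\<^sub>F n in sequentially. norm (x n / of_nat n - L) \<le> C / real n"
      using eventually_gt_at_top[of 0]
    proof eventually_elim
      case (elim n)
      then have "x n / of_nat n - L = (x n - of_nat n * L) / of_nat n" by (simp add: field_simps)
      then show ?case using elim assms[of n] by (simp add: norm_divide divide_right_mono)
    qed
    show "(\<lambda>n. C / real n) \<longlonglongrightarrow> 0" by real_asymp
  qed
  then show ?thesis by (simp add: LIM_zero_iff)
qed

text \<open>Entries are bounded by \<open>M ^ m\<close>, so boundedly many exceptional diagonal
  positions do not affect the limit. For even \<open>m\<close> these lie at the two ends of the
  diagonal; for odd \<open>m\<close> they are the only nonzero ones and lie near the middle.\<close>

lemma trace_mpow_hankel_limit:
  fixes c :: "int \<Rightarrow> real" and a :: "nat \<Rightarrow> nat \<Rightarrow> nat \<Rightarrow> complex"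
  assumes c: "\<And>k. \<bar>k\<bar> > int r \<Longrightarrow> c k = 0"
    and a: "\<And>n s t. a n s t = complex_of_real (c (int n - 1 - int s - int t))"
  shows "(\<lambda>n. (\<Sum>s<n. mpow n (a n) m s s) / of_nat n) \<longlonglongrightarrow>
    (if even m then of_real (1 / (2 * pi) * (LINT \<theta>|leb. cmod (trigpoly r c \<theta>) ^ m)) else 0)"
proof -
  define M where "M = (\<Sum>k=-int r..int r. \<bar>c k\<bar>)"
  have M0: "M \<ge> 0" unfolding M_def by (rule sum_nonneg) simp
  have "(\<Sum>x<n. cmod (a n s x)) \<le> M" for n s
    unfolding a M_def by (rule hankel_row_sum[OF c])
  then have entry: "cmod (mpow n (a n) m s s) \<le> M ^ m" if "s < n" for n s
    using mpow_entry_bound[of n "a n" M s s m] that by blast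
  have an: "a n = (\<lambda>s t. complex_of_real (c (int n - 1 - int s - int t)))" for n
    using a by blast
  show ?thesis
  proof (cases "even m")
    case True
    then obtain k where m: "m = 2 * k" by blast
    define L where "L = complex_of_real (1 / (2 * pi) * (LINT \<theta>|leb. cmod (trigpoly r c \<theta>) ^ m))"
    have "cmod ((\<Sum>s<n. mpow n (a n) m s s) - of_nat n * L) \<le> real (4 * k * r) * (M ^ m + cmod L)" for n
    proof -
      have "cmod (\<Sum>s<n. mpow n (a n) m s s - L) \<le> real (4 * k * r) * (M ^ m + cmod L)"
      proof (rule norm_sum_exceptional)
        show "cmod (mpow n (a n) m s s - L) \<le> M ^ m + cmod L" if "s < n" for s
          using entry[OF that] norm_triangle_ineq4[of "mpow n (a n) m s s" L] by linarith
        \<comment> \<open>There are at most \<open>2 * k * r\<close> exceptions at each end. When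
          \<open>n < 2 * k * r\<close>, truncated subtraction makes the second interval cover all
          indices.\<close>
        show "mpow n (a n) m s s - L = 0" if "s < n" "s \<notin> {..<2 * k * r} \<union> {n - 2 * k * r..<n}" for s
        proof -
          have "2 * k * r \<le> s" "s + 2 * k * r < n" using that by auto
          then have "int (2 * k * r) \<le> int s" "int (s + 2 * k * r) < int n"
            by (simp_all only: of_nat_le_iff of_nat_less_iff)
          then have "int (2 * k * r) \<le> int s" "int s < int n - int (2 * k * r)" by linarith+
          from mpow_hankel_diagonal[OF c this] show ?thesis unfolding an m L_def by simp
        qed
        have "card ({..<2 * k * r} \<union> {n - 2 * k * r..<n}) \<le> card {..<2 * k * r} + card {n - 2 * k * r..<n}"
          by (rule card_Un_le)
        then show "card ({..<2 * k * r} \<union> {n - 2 * k * r..<n}) \<le> 4 * k * r" by simp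
      qed (use M0 in auto)
      then show ?thesis by (simp add: sum_subtractf)
    qed
    from tendsto_div_of_bounded_error[OF this] show ?thesis using True by (simp add: L_def)
  next
    case False
    have "cmod ((\<Sum>s<n. mpow n (a n) m s s) - of_nat n * 0) \<le> real (2 * m * r + 1) * M ^ m" for n
    proof -
      \<comment> \<open>For odd \<open>m\<close> the iterated reflection sends \<open>s\<close> to
        \<open>n - 1 - s\<close>, so the band condition on the diagonal bounds
        \<open>n - 1 - 2 * s\<close>.\<close>
      define E where "E = {s. \<bar>int n - 1 - 2 * int s\<bar> \<le> int (m * r)}"
      have inj: "inj_on (\<lambda>s. int n - 1 - 2 * int s) E" by (auto simp: inj_on_def)
      have img: "(\<lambda>s. int n - 1 - 2 * int s) ` E \<subseteq> {- int (m * r)..int (m * r)}"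
        by (auto simp: E_def)
      have "finite E" using inj img by (meson finite_atLeastAtMost_int finite_imageD finite_subset)
      moreover have "card E \<le> 2 * m * r + 1"
        using card_inj_on_le[OF inj img] by (simp add: nat_add_distrib nat_mult_distrib)
      moreover have "mpow n (a n) m s s = 0" if "s \<notin> E" for s
        unfolding an using that False
        by (intro mpow_hankel_band[of r "\<lambda>k. of_real (c k)"])
           (auto simp: E_def flip_funpow c)
      ultimately have "cmod (\<Sum>s<n. mpow n (a n) m s s) \<le> real (2 * m * r + 1) * M ^ m"
        using M0 entry by (intro norm_sum_exceptional[where E=E]) auto
      then show ?thesis by simp
    qed
    from tendsto_div_of_bounded_error[OF this] show ?thesis using False by simp
  qed
qed

text \<open>The exponential is expanded in moments of the eigenvalues. Since the odd moments tend to
  0, the limiting series is a cosine series.\<close>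

lemma trigpoly_trace_iexp_limit:
  fixes c :: "int \<Rightarrow> real" and l :: "nat \<Rightarrow> nat \<Rightarrow> real"
  assumes c: "\<And>k. \<bar>k\<bar> > int r \<Longrightarrow> c k = 0"
    and sd: "\<And>n. spectral_data n (hankel (trigpoly r c) n) (l n) (u n)"
  shows "(\<lambda>n. (\<Sum>j<n. cis (t * l n j)) / of_nat n) \<longlonglongrightarrow>
    of_real (1 / (2 * pi) * (LINT \<theta>|leb. cos (t * cmod (trigpoly r c \<theta>))))"
proof -
  define q where "q \<theta> = cmod (trigpoly r c \<theta>)" for \<theta>
  define M where "M = (\<Sum>k=-int r..int r. \<bar>c k\<bar>)"
  define a where "a n s t = complex_of_real (c (int n - 1 - int s - int t))" for n s t
  define \<mu> where "\<mu> m n = (\<Sum>j<n. of_real (l n j ^ m)) / complex_of_nat n" for m n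
  have an: "a n = hankel (trigpoly r c) n" for n
    unfolding a_def[abs_def] fourier_coeff_trigpoly by (intro ext) (auto intro!: c)
  have \<mu>: "\<mu> m n = (\<Sum>s<n. mpow n (a n) m s s) / of_nat n" for m n
    unfolding \<mu>_def an trace_mpow[OF sd] ..
  have M0: "M \<ge> 0" unfolding M_def by (rule sum_nonneg) simp
  have row: "(\<Sum>x<n. cmod (a n s x)) \<le> M" for n s
    unfolding a_def M_def by (rule hankel_row_sum[OF c])
  have \<mu>_bound: "cmod (\<mu> m n) \<le> M ^ m" for m n
  proof (cases "n = 0")
    case False
    have "cmod (\<Sum>s<n. mpow n (a n) m s s) \<le> of_nat (card {..<n}) * M ^ m"
      by (rule sum_norm_bound) (auto intro!: mpow_entry_bound row)
    then show ?thesis unfolding \<mu> using False by (simp add: norm_divide field_simps)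
  qed (use M0 in \<open>simp add: \<mu>_def\<close>)
  define b where "b m = (\<i> * of_real t) ^ m /\<^sub>R fact m" for m
  have series: "(\<Sum>j<n. cis (t * l n j)) / of_nat n = (\<Sum>m. b m * \<mu> m n)" for n
  proof -
    have "(\<lambda>m. b m * of_real (l n j ^ m)) sums cis (t * l n j)" for j
      using exp_converges[of "\<i> * of_real t * of_real (l n j)"]
      unfolding b_def by (simp add: cis_conv_exp power_mult_distrib mult_ac)
    then have "(\<lambda>m. \<Sum>j<n. b m * of_real (l n j ^ m)) sums (\<Sum>j<n. cis (t * l n j))"
      by (intro sums_sum)
    then have "(\<lambda>m. (\<Sum>j<n. b m * of_real (l n j ^ m)) / of_nat n) sums ((\<Sum>j<n. cis (t * l n j)) / of_nat n)"
      by (rule sums_divide)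
    then show ?thesis by (simp add: \<mu>_def sums_iff flip: sum_distrib_left)
  qed
  define L where "L m = (if even m then complex_of_real (1 / (2 * pi) * (LINT \<theta>|leb. q \<theta> ^ m)) else 0)" for m
  \<comment> \<open>Tannery's theorem interchanges the limit in \<open>n\<close> with the series;
    the terms are dominated, uniformly in \<open>n\<close>, by the exponential series of
    \<open>\<bar>t\<bar> * M\<close>.\<close>
  have lim: "(\<lambda>n. \<Sum>m. b m * \<mu> m n) \<longlonglongrightarrow> (\<Sum>m. b m * L m)"
  proof -
    have "summable (\<lambda>m. (\<bar>t\<bar> * M) ^ m /\<^sub>R fact m)" by (rule summable_exp_generic)
    moreover have "cmod (b m * \<mu> m n) \<le> (\<bar>t\<bar> * M) ^ m /\<^sub>R fact m" for m n
      using mult_left_mono[OF \<mu>_bound[of m n], of "\<bar>t\<bar> ^ m / fact m"]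
      by (simp add: b_def norm_mult norm_power power_mult_distrib field_simps)
    moreover have "(\<lambda>n. b m * \<mu> m n) \<longlonglongrightarrow> b m * L m" for m
      unfolding \<mu> L_def q_def
      by (intro tendsto_intros trace_mpow_hankel_limit[OF c]) (simp_all add: a_def)
    ultimately show ?thesis
      by (intro tannerys_theorem[where M="\<lambda>m. (\<bar>t\<bar> * M) ^ m /\<^sub>R fact m", THEN conjunct2, THEN conjunct2])
         (auto intro!: always_eventually)
  qed
  have q: "\<bar>q \<theta>\<bar> \<le> M" for \<theta> unfolding q_def M_def using cmod_trigpoly_le[of r c \<theta>] by simp
  have qi: "integrable leb (\<lambda>\<theta>. q \<theta> ^ m)" for m
  proof (rule finite_measure.integrable_const_bound[OF finite_measure_leb, where B="M ^ m"])
    show "AE x in leb. norm (q x ^ m) \<le> M ^ m"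
      using power_mono[OF q] by (auto simp: power_abs intro!: AE_I2)
    show "(\<lambda>\<theta>. q \<theta> ^ m) \<in> borel_measurable leb"
      unfolding q_def by (intro borel_measurable_leb_continuous continuous_intros continuous_on_trigpoly)
  qed
  \<comment> \<open>The cosine series is integrated term by term, dominated by the same exponential
    series times the interval length \<open>2 * pi\<close>.\<close>
  have "(\<lambda>m. LINT \<theta>|leb. cos_coeff m * (t * q \<theta>) ^ m) sums (LINT \<theta>|leb. (\<Sum>m. cos_coeff m * (t * q \<theta>) ^ m))"
  proof (rule sums_integral)
    show "integrable leb (\<lambda>\<theta>. cos_coeff m * (t * q \<theta>) ^ m)" for m
      unfolding power_mult_distrib using qi by simp
    have bd: "norm (cos_coeff m * (t * q \<theta>) ^ m) \<le> (\<bar>t\<bar> * M) ^ m /\<^sub>R fact m" for m \<theta>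
    proof -
      have "\<bar>cos_coeff m\<bar> \<le> 1 / fact m" by (auto simp: cos_coeff_def power_abs)
      moreover have "\<bar>t * q \<theta>\<bar> ^ m \<le> (\<bar>t\<bar> * M) ^ m"
        using q[of \<theta>] by (intro power_mono) (auto simp: abs_mult mult_left_mono)
      ultimately have "\<bar>cos_coeff m\<bar> * \<bar>t * q \<theta>\<bar> ^ m \<le> 1 / fact m * (\<bar>t\<bar> * M) ^ m"
        by (intro mult_mono) auto
      then show ?thesis
        by (simp only: real_norm_def real_scaleR_def inverse_eq_divide abs_mult[of "cos_coeff m"] power_abs)
    qed
    show "AE \<theta> in leb. summable (\<lambda>m. norm (cos_coeff m * (t * q \<theta>) ^ m))"
      using summable_norm_cos[of "t * q \<theta>" for \<theta>] by (auto intro!: AE_I2)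
    show "summable (\<lambda>m. LINT \<theta>|leb. norm (cos_coeff m * (t * q \<theta>) ^ m))"
    proof (rule summable_comparison_test)
      show "\<exists>N. \<forall>m\<ge>N. norm (LINT \<theta>|leb. norm (cos_coeff m * (t * q \<theta>) ^ m)) \<le> (\<bar>t\<bar> * M) ^ m /\<^sub>R fact m * (2 * pi)"
      proof (intro exI allI impI)
        fix m
        have "(LINT \<theta>|leb. norm (cos_coeff m * (t * q \<theta>) ^ m)) \<le> (LINT \<theta>|leb. (\<bar>t\<bar> * M) ^ m /\<^sub>R fact m)"
          using bd qi finite_measure.integrable_const[OF finite_measure_leb]
          by (intro integral_mono) (auto simp: power_mult_distrib)
        then show "norm (LINT \<theta>|leb. norm (cos_coeff m * (t * q \<theta>) ^ m)) \<le> (\<bar>t\<bar> * M) ^ m /\<^sub>R fact m * (2 * pi)"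
          by (simp add: measure_restrict_space mult_ac)
      qed
      show "summable (\<lambda>m. (\<bar>t\<bar> * M) ^ m /\<^sub>R fact m * (2 * pi))"
        by (intro summable_mult2 summable_exp_generic)
    qed
  qed
  moreover have "(\<Sum>m. cos_coeff m * (t * q \<theta>) ^ m) = cos (t * q \<theta>)" for \<theta>
    using cos_converges[of "t * q \<theta>"] by (simp add: sums_iff)
  ultimately have "(\<lambda>m. LINT \<theta>|leb. cos_coeff m * (t * q \<theta>) ^ m) sums (LINT \<theta>|leb. cos (t * q \<theta>))"
    by simp
  then have "(\<lambda>m. complex_of_real (1 / (2 * pi) * (LINT \<theta>|leb. cos_coeff m * (t * q \<theta>) ^ m)))
     sums of_real (1 / (2 * pi) * (LINT \<theta>|leb. cos (t * q \<theta>)))"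
    by (intro sums_of_real sums_mult)
  \<comment> \<open>For odd \<open>m\<close> both sides vanish; for \<open>m = 2 * k\<close> the
    factor \<open>\<i> ^ m\<close> is the sign in the cosine coefficient.\<close>
  moreover have "complex_of_real (1 / (2 * pi) * (LINT \<theta>|leb. cos_coeff m * (t * q \<theta>) ^ m)) = b m * L m" for m
  proof (cases "even m")
    case True
    then obtain k where m: "m = 2 * k" by blast
    have "b m = of_real (cos_coeff m * t ^ m)"
    proof -
      have "(\<i> ^ k)\<^sup>2 = (\<i>\<^sup>2) ^ k" by (simp only: power_mult[symmetric] mult.commute)
      then show ?thesis
        unfolding b_def m cos_coeff_def by (simp add: power_mult_distrib power_mult scaleR_conv_of_real field_simps)
    qed
    then show ?thesis using True by (simp add: L_def power_mult_distrib mult.assoc)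
  qed (simp add: L_def cos_coeff_def)
  ultimately have "(\<Sum>m. b m * L m) = of_real (1 / (2 * pi) * (LINT \<theta>|leb. cos (t * q \<theta>)))"
    by (simp add: sums_iff)
  then show ?thesis using lim unfolding series q_def by simp
qed

subsection \<open>Convergence of Fejer means\<close>

text \<open>The difference \<open>k\<close> occurs for \<open>N + 1 - |k|\<close> pairs when
  \<open>|k| \<le> N\<close>, so this is the Cesaro mean of the Fourier partial sums. The double sum
  displays the kernel as a squared modulus.\<close>

definition fejer :: "nat \<Rightarrow> (real \<Rightarrow> complex) \<Rightarrow> real \<Rightarrow> complex" where
  "fejer N f \<theta> = (\<Sum>i\<le>N. \<Sum>j\<le>N. fourier_coeff f (int i - int j) * cis (of_int (int i - int j) * \<theta>)) / of_nat (Suc N)"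

lemma continuous_on_fejer: "continuous_on UNIV (fejer N f)"
  unfolding fejer_def[abs_def] by (intro continuous_intros) (simp del: of_nat_Suc)

lemma integrable_fejer: "integrable leb (fejer N f)"
proof -
  have "cmod (fejer N f \<theta>) \<le> (\<Sum>i\<le>N. \<Sum>j\<le>N. cmod (fourier_coeff f (int i - int j)))" for \<theta>
  proof -
    have "cmod (\<Sum>i\<le>N. \<Sum>j\<le>N. fourier_coeff f (int i - int j) * cis (of_int (int i - int j) * \<theta>))
       \<le> (\<Sum>i\<le>N. \<Sum>j\<le>N. cmod (fourier_coeff f (int i - int j)))"
      by (intro sum_norm_le) (simp add: norm_mult)
    also have "\<dots> \<le> (\<Sum>i\<le>N. \<Sum>j\<le>N. cmod (fourier_coeff f (int i - int j))) * real (Suc N)"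
      by (simp add: mult_le_cancel_left1 not_less sum_nonneg algebra_simps)
    finally show ?thesis by (simp add: fejer_def norm_divide divide_le_eq del: of_nat_Suc)
  qed
  then show ?thesis by (rule integrable_leb_continuous_bounded[OF continuous_on_fejer])
qed

lemma fourier_coeff_diff:
  assumes "integrable leb f" "integrable leb g"
  shows "fourier_coeff (\<lambda>x. f x - g x) k = fourier_coeff f k - fourier_coeff g k"
  using integrable_leb_times_cis[OF assms(1), of "- of_int k"] integrable_leb_times_cis[OF assms(2), of "- of_int k"]
  unfolding fourier_coeff_leb left_diff_distrib by (simp add: right_diff_distrib)

lemma fourier_coeff_add:
  assumes "integrable leb f" "integrable leb g"
  shows "fourier_coeff (\<lambda>x. f x + g x) k = fourier_coeff f k + fourier_coeff g k"
  using integrable_leb_times_cis[OF assms(1), of "- of_int k"] integrable_leb_times_cis[OF assms(2), of "- of_int k"]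
  unfolding fourier_coeff_leb distrib_right by (simp add: distrib_left)

lemma fejer_diff:
  assumes "integrable leb f" "integrable leb g"
  shows "fejer N (\<lambda>x. f x - g x) \<theta> = fejer N f \<theta> - fejer N g \<theta>"
  by (simp add: fejer_def fourier_coeff_diff[OF assms] left_diff_distrib sum_subtractf diff_divide_distrib)

lemma fejer_add:
  assumes "integrable leb f" "integrable leb g"
  shows "fejer N (\<lambda>x. f x + g x) \<theta> = fejer N f \<theta> + fejer N g \<theta>"
  by (simp add: fejer_def fourier_coeff_add[OF assms] distrib_right sum.distrib add_divide_distrib)

lemma fejer_kernel:
  assumes f: "integrable leb f"
  shows "fejer N f \<theta> = (LINT \<phi>|leb. f \<phi> * of_real ((cmod (\<Sum>i\<le>N. cis (real i * (\<theta> - \<phi>))))\<^sup>2)) / of_real (2 * pi * real (Suc N))"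
proof -
  have "(\<Sum>i\<le>N. \<Sum>j\<le>N. (LINT \<phi>|leb. f \<phi> * cis (- of_int (int i - int j) * \<phi>)) * cis (of_int (int i - int j) * \<theta>))
    = (LINT \<phi>|leb. (\<Sum>i\<le>N. \<Sum>j\<le>N. f \<phi> * cis (- of_int (int i - int j) * \<phi>) * cis (of_int (int i - int j) * \<theta>)))"
    by (rule has_bochner_integral_integral_eq[symmetric], intro has_bochner_integral_sum
        has_bochner_integral_mult_left has_bochner_integral_integrable integrable_leb_times_cis[OF f])
  also have "(\<lambda>\<phi>. \<Sum>i\<le>N. \<Sum>j\<le>N. f \<phi> * cis (- of_int (int i - int j) * \<phi>) * cis (of_int (int i - int j) * \<theta>))
    = (\<lambda>\<phi>. f \<phi> * of_real ((cmod (\<Sum>i\<le>N. cis (real i * (\<theta> - \<phi>))))\<^sup>2))"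
    unfolding complex_norm_square cnj_sum sum_product unfolding sum_distrib_left
    by (intro ext sum.cong refl) (simp add: cis_cnj cis_mult mult.assoc algebra_simps)
  finally show ?thesis
    unfolding fejer_def fourier_coeff_leb by (simp add: sum_distrib_left[symmetric] mult.assoc field_simps flip: sum_divide_distrib)
qed

text \<open>The Fejer kernel is nonnegative, so \<open>\<bar>fejer N f\<bar> \<le> fejer N \<bar>f\<bar>\<close>, and only the constant
  coefficient of \<open>fejer N \<bar>f\<bar>\<close> contributes to its integral.\<close>

lemma fejer_contraction:
  assumes f: "integrable leb f"
  shows "(LINT \<theta>|leb. cmod (fejer N f \<theta>)) \<le> (LINT \<theta>|leb. cmod (f \<theta>))"
proof -
  define g where "g \<theta> = complex_of_real (cmod (f \<theta>))" for \<theta>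
  have g: "integrable leb g" using f unfolding g_def[abs_def] by simp
  have le: "cmod (fejer N f \<theta>) \<le> Re (fejer N g \<theta>)" for \<theta>
  proof -
    define D where "D \<phi> = (cmod (\<Sum>i\<le>N. cis (real i * (\<theta> - \<phi>))))\<^sup>2" for \<phi>
    have pos: "0 < 2 * pi * real (Suc N)" by simp
    have "cmod (fejer N f \<theta>) \<le> (LINT \<phi>|leb. cmod (f \<phi> * of_real (D \<phi>))) / (2 * pi * real (Suc N))"
      unfolding fejer_kernel[OF f] D_def[symmetric] norm_divide norm_of_real abs_of_pos[OF pos]
      by (intro divide_right_mono Bochner_Integration.integral_norm_bound less_imp_le pos)
    also have "\<dots> = (LINT \<phi>|leb. cmod (f \<phi>) * D \<phi>) / (2 * pi * real (Suc N))"
      unfolding norm_mult norm_of_real by (simp add: D_def)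
    also have "\<dots> = Re (fejer N g \<theta>)"
    proof -
      have "(LINT \<phi>|leb. g \<phi> * of_real (D \<phi>)) = of_real (LINT \<phi>|leb. cmod (f \<phi>) * D \<phi>)"
        unfolding g_def of_real_mult[symmetric] by (rule integral_complex_of_real)
      then show ?thesis unfolding fejer_kernel[OF g] D_def[symmetric] by (simp only: Re_complex_of_real flip: of_real_divide)
    qed
    finally show ?thesis .
  qed
  have "(LINT \<theta>|leb. cmod (fejer N f \<theta>)) \<le> (LINT \<theta>|leb. Re (fejer N g \<theta>))"
    by (intro Bochner_Integration.integral_mono le integrable_norm integrable_fejer integrable_Re)
  also have "\<dots> = Re (LINT \<theta>|leb. fejer N g \<theta>)"
    by (rule integral_Re[OF integrable_fejer])
  also have "(LINT \<theta>|leb. fejer N g \<theta>) = (\<Sum>i\<le>N. \<Sum>j\<le>N. fourier_coeff g (int i - int j) *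
      (LINT \<theta>|leb. cis (of_int (int i - int j) * \<theta>))) / of_nat (Suc N)"
    unfolding fejer_def by (rule has_bochner_integral_integral_eq, intro has_bochner_integral_divide_zero has_bochner_integral_sum
        has_bochner_integral_mult_right has_bochner_integral_integrable integrable_leb_cis)
  also have "\<dots> = (\<Sum>i\<le>N. \<Sum>j\<le>N. if j = i then fourier_coeff g 0 * of_real (2 * pi) else 0) / of_nat (Suc N)"
    unfolding LINT_leb_cis by (intro arg_cong2[of _ _ _ _ "(/)"] sum.cong refl) auto
  also have "\<dots> = fourier_coeff g 0 * of_real (2 * pi)"
    by (simp del: of_nat_Suc)
  also have "\<dots> = of_real (LINT \<theta>|leb. cmod (f \<theta>))"
    unfolding fourier_coeff_leb by (simp add: g_def)
  finally show ?thesis by simp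
qed

section \<open>Convergence in the mean, first for exponentials and then by density\<close>

definition fejer_converges :: "(real \<Rightarrow> complex) \<Rightarrow> bool" where
  "fejer_converges f \<longleftrightarrow> integrable leb f \<and> (\<lambda>N. LINT \<theta>|leb. cmod (fejer N f \<theta> - f \<theta>)) \<longlonglongrightarrow> 0"

lemma LINT_cmod_triangle:
  assumes "integrable leb f" "integrable leb g"
  shows "(LINT \<theta>|leb. cmod (f \<theta> + g \<theta>)) \<le> (LINT \<theta>|leb. cmod (f \<theta>)) + (LINT \<theta>|leb. cmod (g \<theta>))"
  unfolding Bochner_Integration.integral_add[OF integrable_norm[OF assms(1)] integrable_norm[OF assms(2)], symmetric]
  by (intro Bochner_Integration.integral_mono integrable_norm Bochner_Integration.integrable_add assms norm_triangle_ineq)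

text \<open>The error splits into the Fejer mean of \<open>f - g\<close>, the error for
  \<open>g\<close>, and \<open>f - g\<close> itself. By \<open>fejer_contraction\<close> the first
  part is no larger than the third, so each is below \<open>e / 3\<close> for large
  \<open>N\<close>.\<close>

lemma fejer_converges_approx:
  assumes f: "integrable leb f"
    and approx: "\<And>e. e > 0 \<Longrightarrow> \<exists>g. fejer_converges g \<and> (LINT \<theta>|leb. cmod (f \<theta> - g \<theta>)) < e"
  shows "fejer_converges f"
  unfolding fejer_converges_def
proof (intro conjI f LIMSEQ_I)
  fix e :: real assume "e > 0"
  then obtain g where "fejer_converges g" and fg: "(LINT \<theta>|leb. cmod (f \<theta> - g \<theta>)) < e / 3"
    using approx[of "e / 3"] by auto
  then have g: "integrable leb g" and lim: "(\<lambda>N. LINT \<theta>|leb. cmod (fejer N g \<theta> - g \<theta>)) \<longlonglongrightarrow> 0"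
    by (auto simp: fejer_converges_def)
  have h: "integrable leb (\<lambda>\<theta>. f \<theta> - g \<theta>)" using f g by simp
  obtain N0 where N0: "\<And>N. N \<ge> N0 \<Longrightarrow> (LINT \<theta>|leb. cmod (fejer N g \<theta> - g \<theta>)) < e / 3"
    using LIMSEQ_D[OF lim, of "e / 3"] \<open>e > 0\<close> by auto
  have "(LINT \<theta>|leb. cmod (fejer N f \<theta> - f \<theta>)) < e" if "N \<ge> N0" for N
  proof -
    have "(LINT \<theta>|leb. cmod (fejer N f \<theta> - f \<theta>))
      = (LINT \<theta>|leb. cmod (fejer N (\<lambda>\<theta>. f \<theta> - g \<theta>) \<theta> + ((fejer N g \<theta> - g \<theta>) - (f \<theta> - g \<theta>))))"
      unfolding fejer_diff[OF f g] by simp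
    also have "\<dots> \<le> (LINT \<theta>|leb. cmod (fejer N (\<lambda>\<theta>. f \<theta> - g \<theta>) \<theta>)) +
       (LINT \<theta>|leb. cmod ((fejer N g \<theta> - g \<theta>) + - (f \<theta> - g \<theta>)))"
      using f g by (simp add: LINT_cmod_triangle integrable_fejer)
    also have "(LINT \<theta>|leb. cmod ((fejer N g \<theta> - g \<theta>) + - (f \<theta> - g \<theta>)))
       \<le> (LINT \<theta>|leb. cmod (fejer N g \<theta> - g \<theta>)) + (LINT \<theta>|leb. cmod (- (f \<theta> - g \<theta>)))"
      using f g by (intro LINT_cmod_triangle) (simp_all add: integrable_fejer)
    also have "(LINT \<theta>|leb. cmod (fejer N (\<lambda>\<theta>. f \<theta> - g \<theta>) \<theta>)) \<le> (LINT \<theta>|leb. cmod (f \<theta> - g \<theta>))"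
      by (rule fejer_contraction[OF h])
    finally show ?thesis using N0[OF that] fg unfolding norm_minus_cancel by linarith
  qed
  then show "\<exists>N0. \<forall>N\<ge>N0. norm ((LINT \<theta>|leb. cmod (fejer N f \<theta> - f \<theta>)) - 0) < e"
    by (auto simp: integral_nonneg_AE)
qed

lemma fejer_converges_add:
  assumes "fejer_converges f" "fejer_converges g"
  shows "fejer_converges (\<lambda>\<theta>. f \<theta> + g \<theta>)"
proof -
  have f: "integrable leb f" and g: "integrable leb g"
    and limf: "(\<lambda>N. LINT \<theta>|leb. cmod (fejer N f \<theta> - f \<theta>)) \<longlonglongrightarrow> 0"
    and limg: "(\<lambda>N. LINT \<theta>|leb. cmod (fejer N g \<theta> - g \<theta>)) \<longlonglongrightarrow> 0"
    using assms by (auto simp: fejer_converges_def)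
  have "(\<lambda>N. LINT \<theta>|leb. cmod (fejer N (\<lambda>\<theta>. f \<theta> + g \<theta>) \<theta> - (f \<theta> + g \<theta>))) \<longlonglongrightarrow> 0"
  proof (rule Lim_null_comparison)
    have "(LINT \<theta>|leb. cmod (fejer N (\<lambda>\<theta>. f \<theta> + g \<theta>) \<theta> - (f \<theta> + g \<theta>)))
      \<le> (LINT \<theta>|leb. cmod (fejer N f \<theta> - f \<theta>)) + (LINT \<theta>|leb. cmod (fejer N g \<theta> - g \<theta>))" for N
      using LINT_cmod_triangle[of "\<lambda>\<theta>. fejer N f \<theta> - f \<theta>" "\<lambda>\<theta>. fejer N g \<theta> - g \<theta>"] f g
      by (simp add: fejer_add[OF f g] integrable_fejer algebra_simps)
    then show "\<forall>\<^sub>F N in sequentially. norm (LINT \<theta>|leb. cmod (fejer N (\<lambda>\<theta>. f \<theta> + g \<theta>) \<theta> - (f \<theta> + g \<theta>)))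
      \<le> (LINT \<theta>|leb. cmod (fejer N f \<theta> - f \<theta>)) + (LINT \<theta>|leb. cmod (fejer N g \<theta> - g \<theta>))"
      by (simp add: integral_nonneg_AE)
    show "(\<lambda>N. (LINT \<theta>|leb. cmod (fejer N f \<theta> - f \<theta>)) + (LINT \<theta>|leb. cmod (fejer N g \<theta> - g \<theta>))) \<longlonglongrightarrow> 0"
      using tendsto_add[OF limf limg] by simp
  qed
  then show ?thesis using f g by (simp add: fejer_converges_def)
qed

lemma fejer_converges_cis: "fejer_converges (\<lambda>\<theta>. z * cis (of_int k * \<theta>))"
proof -
  define f where "f \<theta> = z * cis (of_int k * \<theta>)" for \<theta>
  have f: "integrable leb f" unfolding f_def[abs_def] by (intro integrable_mult_right integrable_leb_cis)
  have fc: "fourier_coeff f m = (if m = k then z else 0)" for m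
  proof -
    have "(LINT \<theta>|leb. f \<theta> * cis (- (of_int m * \<theta>))) = (LINT \<theta>|leb. z * cis (of_int (k - m) * \<theta>))"
      unfolding f_def mult.assoc cis_mult by (simp add: algebra_simps)
    also have "\<dots> = z * (if m = k then of_real (2 * pi) else 0)"
      unfolding Bochner_Integration.integral_mult_right_zero LINT_leb_cis by simp
    finally show ?thesis unfolding fourier_coeff_leb by simp
  qed
  have "cmod (fejer N f \<theta> - f \<theta>) \<le> \<bar>of_int k\<bar> * cmod z / real (Suc N)" for N \<theta>
  proof -
    \<comment> \<open>This indicates whether the partner \<open>i = j + k\<close> lies in the index
      range. At most \<open>|k|\<close> indices \<open>j\<close> lack a partner: the first ones for
      negative \<open>k\<close>, the last ones for positive \<open>k\<close>.\<close>
    define I where "I j = (if 0 \<le> int j + k \<and> int j + k \<le> int N then 1 else 0 :: complex)" for j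
    have "(\<Sum>i\<le>N. \<Sum>j\<le>N. fourier_coeff f (int i - int j) * cis (of_int (int i - int j) * \<theta>))
      = (\<Sum>j\<le>N. \<Sum>i\<le>N. if i = nat (int j + k) \<and> 0 \<le> int j + k then f \<theta> else 0)"
      by (subst sum.swap, intro sum.cong refl) (auto simp: fc f_def)
    also have "\<dots> = (\<Sum>j\<le>N. I j * f \<theta>)"
    proof (intro sum.cong refl)
      fix j
      show "(\<Sum>i\<le>N. if i = nat (int j + k) \<and> 0 \<le> int j + k then f \<theta> else 0) = I j * f \<theta>"
        by (cases "0 \<le> int j + k") (auto simp: I_def nat_le_iff)
    qed
    finally have "fejer N f \<theta> = (\<Sum>j\<le>N. I j) * f \<theta> / of_nat (Suc N)"
      by (simp add: fejer_def sum_distrib_right)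
    then have "fejer N f \<theta> - f \<theta> = (\<Sum>j<Suc N. I j - 1) * f \<theta> / of_nat (Suc N)"
      by (simp add: sum_subtractf field_simps lessThan_Suc_atMost del: of_nat_Suc)
    moreover have "cmod (\<Sum>j<Suc N. I j - 1) \<le> real (nat \<bar>k\<bar>) * 1"
    proof (rule norm_sum_exceptional)
      show "I j - 1 = 0" if "j < Suc N" "j \<notin> {..<nat (- k)} \<union> {Suc N - nat k..<Suc N}" for j
        using that by (auto simp: I_def)
      have "card ({..<nat (- k)} \<union> {Suc N - nat k..<Suc N}) \<le> card {..<nat (- k)} + card {Suc N - nat k..<Suc N}"
        by (rule card_Un_le)
      also have "\<dots> \<le> nat \<bar>k\<bar>" by auto
      finally show "card ({..<nat (- k)} \<union> {Suc N - nat k..<Suc N}) \<le> nat \<bar>k\<bar>" .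
    qed (auto simp: I_def)
    then have "cmod (\<Sum>j<Suc N. I j - 1) * cmod z \<le> \<bar>of_int k\<bar> * cmod z"
      by (intro mult_right_mono) auto
    ultimately show ?thesis
      by (simp add: norm_mult norm_divide f_def divide_right_mono del: of_nat_Suc sum.lessThan_Suc)
  qed
  then have le: "(LINT \<theta>|leb. cmod (fejer N f \<theta> - f \<theta>)) \<le> (LINT \<theta>|leb. \<bar>of_int k\<bar> * cmod z / real (Suc N))" for N
    using f finite_measure.integrable_const[OF finite_measure_leb]
    by (intro Bochner_Integration.integral_mono) (auto simp: integrable_fejer)
  have "(\<lambda>N. LINT \<theta>|leb. cmod (fejer N f \<theta> - f \<theta>)) \<longlonglongrightarrow> 0"
  proof (rule Lim_null_comparison)
    show "\<forall>\<^sub>F N in sequentially. norm (LINT \<theta>|leb. cmod (fejer N f \<theta> - f \<theta>)) \<le> 2 * pi * (\<bar>of_int k\<bar> * cmod z) / real (Suc N)"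
      using le by (intro always_eventually allI)
        (simp add: integral_nonneg_AE measure_restrict_space mult.assoc del: of_nat_Suc)
    show "(\<lambda>N. 2 * pi * (\<bar>of_int k\<bar> * cmod z) / real (Suc N)) \<longlonglongrightarrow> 0"
      by (rule tendsto_divide_0[OF tendsto_const filterlim_at_top_imp_at_infinity])
         (intro filterlim_compose[OF filterlim_real_sequentially] filterlim_Suc)
  qed
  then show ?thesis using f unfolding fejer_converges_def f_def by blast
qed

text \<open>These are the trigonometric polynomials with complex coefficients. Generating them by
  sums lets convergence and closure under products be shown by induction.\<close>

inductive trig_span :: "(real \<Rightarrow> complex) \<Rightarrow> bool" where
  trig_span_cis: "trig_span (\<lambda>\<theta>. z * cis (of_int k * \<theta>))"
| trig_span_add: "trig_span f \<Longrightarrow> trig_span g \<Longrightarrow> trig_span (\<lambda>\<theta>. f \<theta> + g \<theta>)"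

lemma trig_span_fejer_converges: "trig_span f \<Longrightarrow> fejer_converges f"
  by (induction rule: trig_span.induct) (auto intro: fejer_converges_cis fejer_converges_add)

lemma trig_span_mult:
  assumes "trig_span f" "trig_span g"
  shows "trig_span (\<lambda>\<theta>. f \<theta> * g \<theta>)"
  using assms
proof (induction arbitrary: g rule: trig_span.induct)
  case (trig_span_cis z k)
  from trig_span_cis show ?case
  proof (induction rule: trig_span.induct)
    case (trig_span_cis w m)
    have eq: "z * cis (of_int k * \<theta>) * (w * cis (of_int m * \<theta>)) = (z * w) * cis (of_int (k + m) * \<theta>)" for \<theta>
      by (simp add: algebra_simps cis_mult)
    show ?case unfolding eq by (rule trig_span.trig_span_cis)
  next
    case (trig_span_add f g)
    then show ?case using trig_span.trig_span_add by (simp add: distrib_left)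
  qed
next
  case (trig_span_add f1 f2)
  then show ?case using trig_span.trig_span_add by (simp add: distrib_right)
qed

text \<open>Linear functionals on the circle are combinations of \<open>cis \<theta>\<close> and its
  conjugate by Euler's formula. The sign in \<open>- cis \<theta>\<close> shifts the angle by
  \<open>pi\<close>, matching \<open>[-pi, pi)\<close> with the range \<open>[0, 2 * pi)\<close> of
  \<open>Arg2pi\<close>.\<close>

lemma trig_span_polynomial:
  assumes "real_polynomial_function p"
  shows "trig_span (\<lambda>\<theta>. complex_of_real (p (- cis \<theta>)))"
  using assms
proof (induction rule: real_polynomial_function.induct)
  case (linear p)
  interpret bounded_linear p by fact
  have "complex_of_real (p (- cis \<theta>)) = (- of_real (p 1) / 2 + \<i> * of_real (p \<i>) / 2) * cis (of_int 1 * \<theta>)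
      + (- of_real (p 1) / 2 - \<i> * of_real (p \<i>) / 2) * cis (of_int (-1) * \<theta>)" for \<theta>
  proof -
    have "- cis \<theta> = (- cos \<theta>) *\<^sub>R 1 + (- sin \<theta>) *\<^sub>R \<i>"
      by (simp add: complex_eq_iff)
    then have "p (- cis \<theta>) = - cos \<theta> * p 1 - sin \<theta> * p \<i>"
      by (simp only: add scaleR real_scaleR_def)
    then show ?thesis by (simp add: complex_eq_iff)
  qed
  then show ?case
    using trig_span_add[OF trig_span_cis[of "- of_real (p 1) / 2 + \<i> * of_real (p \<i>) / 2" 1]
       trig_span_cis[of "- of_real (p 1) / 2 - \<i> * of_real (p \<i>) / 2" "-1"]] by simp
next
  case (const c)
  show ?case using trig_span_cis[of "of_real c" 0] by simp
next
  case (add f g)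
  then show ?case using trig_span_add by simp
next
  case (mult f g)
  then show ?case using trig_span_mult by simp
qed

lemma LINT_leb_le_const:
  fixes h :: "real \<Rightarrow> real"
  assumes "integrable leb h" "\<And>x. x \<in> {-pi..pi} \<Longrightarrow> h x \<le> e"
  shows "(LINT x|leb. h x) \<le> 2 * pi * e"
proof -
  have "(LINT x|leb. h x) \<le> (LINT x|leb. e)"
    using assms finite_measure.integrable_const[OF finite_measure_leb] by (intro Bochner_Integration.integral_mono) auto
  then show ?thesis by (simp add: measure_restrict_space)
qed

text \<open>Equal end values make \<open>g\<close> a continuous function on the unit circle.
  Stone-Weierstrass approximates it there uniformly by polynomials, which become trigonometric
  polynomials in \<open>\<theta>\<close>.\<close>

lemma fejer_converges_continuous:
  assumes g: "continuous_on {-pi..pi} g" and ends: "g (- pi) = g pi"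
  shows "fejer_converges g"
proof (rule fejer_converges_approx)
  show gi: "integrable leb g"
    unfolding integrable_leb_iff by (rule absolutely_integrable_continuous_real[OF g])
  fix e :: real assume e: "e > 0"
  define p where "p u = g (2 * pi * u - pi)" for u
  have "path p"
    unfolding path_def p_def
    by (intro continuous_on_compose2[OF g] continuous_intros) (auto simp: field_simps)
  moreover have "pathfinish p = pathstart p" by (simp add: pathfinish_def pathstart_def p_def ends)
  \<comment> \<open>The trivial homotopy serves to obtain continuity of the circle map induced by
    the loop \<open>p\<close>.\<close>
  ultimately have "homotopic_loops UNIV p p" by (simp add: homotopic_loops_refl)
  from homotopic_with_imp_continuous[OF homotopic_loops_imp_homotopic_circlemaps[OF this]]
  have ch: "continuous_on (sphere 0 1) (p \<circ> (\<lambda>z. Arg2pi z / (2 * pi)))" by simp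
  obtain P :: "complex \<Rightarrow> complex" where P: "polynomial_function P"
    and near: "\<And>z. z \<in> sphere 0 1 \<Longrightarrow> norm ((p \<circ> (\<lambda>z. Arg2pi z / (2 * pi))) z - P z) < e / (4 * pi)"
    using Stone_Weierstrass_polynomial_function[OF compact_sphere ch, of "e / (4 * pi)"] e by auto
  have "real_polynomial_function (Re \<circ> P)" "real_polynomial_function (Im \<circ> P)"
    using P bounded_linear_Re bounded_linear_Im unfolding polynomial_function_def by blast+
  from this[THEN trig_span_polynomial]
  have "trig_span (\<lambda>\<theta>. of_real ((Re \<circ> P) (- cis \<theta>)) + \<i> * cis (of_int 0 * \<theta>) * of_real ((Im \<circ> P) (- cis \<theta>)))"
    by (intro trig_span_add trig_span_mult trig_span_cis)
  moreover have "of_real ((Re \<circ> P) (- cis \<theta>)) + \<i> * cis (of_int 0 * \<theta>) * of_real ((Im \<circ> P) (- cis \<theta>)) = P (- cis \<theta>)" for \<theta>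
    by (simp add: complex_eq_iff)
  ultimately have span: "trig_span (\<lambda>\<theta>. P (- cis \<theta>))" by simp
  have "cmod (g \<theta> - P (- cis \<theta>)) \<le> e / (4 * pi)" if "\<theta> \<in> {-pi..pi}" for \<theta>
  proof -
    have m: "- cis \<theta> = cis (\<theta> + pi)" by (simp add: complex_eq_iff)
    have "(p \<circ> (\<lambda>z. Arg2pi z / (2 * pi))) (- cis \<theta>) = g \<theta>"
    \<comment> \<open>At \<open>\<theta> = pi\<close> the angle \<open>\<theta> + pi\<close> wraps
      around to 0, where \<open>p\<close> takes the value \<open>g (- pi)\<close>, equal to
      \<open>g pi\<close>.\<close>
    proof (cases "\<theta> = pi")
      case True
      moreover have "Arg2pi 1 = 0" by (rule Arg2pi_unique[of 1]) auto
      ultimately show ?thesis using ends by (simp add: p_def)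
    next
      case False
      then have "Arg2pi (- cis \<theta>) = \<theta> + pi"
        unfolding m using that by (intro Arg2pi_unique[of 1]) (auto simp: cis_conv_exp)
      then show ?thesis by (simp add: p_def)
    qed
    then show ?thesis using near[of "- cis \<theta>"] by simp
  qed
  then have "(LINT \<theta>|leb. cmod (g \<theta> - P (- cis \<theta>))) \<le> 2 * pi * (e / (4 * pi))"
    using gi trig_span_fejer_converges[OF span] unfolding fejer_converges_def
    by (intro LINT_leb_le_const) auto
  also have "\<dots> < e" using e by simp
  finally show "\<exists>h. fejer_converges h \<and> (LINT \<theta>|leb. cmod (g \<theta> - h \<theta>)) < e"
    using trig_span_fejer_converges[OF span] by blast
qed

lemma fejer_converges_dominated:
  assumes f: "integrable leb f" and g: "\<And>n. fejer_converges (g n)"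
    and lim: "AE \<theta> in leb. (\<lambda>n. g n \<theta>) \<longlonglongrightarrow> f \<theta>"
    and bound: "\<And>n \<theta>. cmod (f \<theta> - g n \<theta>) \<le> w \<theta>" and w: "integrable leb w"
  shows "fejer_converges f"
proof (rule fejer_converges_approx[OF f])
  fix e :: real assume e: "e > 0"
  have gi: "integrable leb (g n)" for n using g unfolding fejer_converges_def by blast
  have "(\<lambda>n. LINT \<theta>|leb. cmod (f \<theta> - g n \<theta>)) \<longlonglongrightarrow> (LINT \<theta>|leb. 0)"
  proof (rule integral_dominated_convergence[where w = w])
    show "AE \<theta> in leb. (\<lambda>n. cmod (f \<theta> - g n \<theta>)) \<longlonglongrightarrow> 0"
      using lim
    proof eventually_elim
      case (elim \<theta>)
      then have "(\<lambda>n. cmod (f \<theta> - g n \<theta>)) \<longlonglongrightarrow> cmod (f \<theta> - f \<theta>)" by (intro tendsto_intros)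
      then show ?case by simp
    qed
  qed (use f gi w bound in \<open>auto intro!: borel_measurable_norm borel_measurable_diff\<close>)
  then have "(\<lambda>n. LINT \<theta>|leb. cmod (f \<theta> - g n \<theta>)) \<longlonglongrightarrow> 0" by simp
  from order_tendstoD(2)[OF this e] obtain n where "(LINT \<theta>|leb. cmod (f \<theta> - g n \<theta>)) < e"
    by (auto simp: eventually_sequentially)
  then show "\<exists>g. fejer_converges g \<and> (LINT \<theta>|leb. cmod (f \<theta> - g \<theta>)) < e" using g by blast
qed

text \<open>For \<open>B > 0\<close> this is the radial retraction onto the closed disc of radius
  \<open>B\<close>. Written with \<open>max\<close> it needs no case distinction, so continuity and
  measurability follow from the formula.\<close>

definition radial_clamp :: "real \<Rightarrow> complex \<Rightarrow> complex" where
  "radial_clamp B z = z /\<^sub>R max 1 (cmod z / B)"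

lemma radial_clamp_norm_le: "B > 0 \<Longrightarrow> cmod (radial_clamp B z) \<le> B"
  by (auto simp: radial_clamp_def max_def field_simps)

lemma radial_clamp_norm_le': "cmod (radial_clamp B z) \<le> cmod z"
proof -
  have "inverse (max 1 (cmod z / B)) * cmod z \<le> 1 * cmod z"
    by (intro mult_right_mono) (auto simp: inverse_le_1_iff)
  then show ?thesis by (simp add: radial_clamp_def)
qed

lemma radial_clamp_eq: "cmod z \<le> B \<Longrightarrow> radial_clamp B z = z"
proof -
  assume z: "cmod z \<le> B"
  then have "B \<ge> 0" by (rule order_trans[OF norm_ge_zero])
  with z have "cmod z / B \<le> 1" by (auto simp: divide_le_eq_1)
  then show ?thesis by (simp add: radial_clamp_def max_absorb1)
qed

lemma continuous_on_radial_clamp: "B > 0 \<Longrightarrow> continuous_on S g \<Longrightarrow> continuous_on S (\<lambda>x. radial_clamp B (g x))"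
  unfolding radial_clamp_def by (intro continuous_intros) (auto simp: max_def)

text \<open>Measurability supplies continuous functions converging to \<open>f\<close> off a
  negligible set. Clamping them keeps them bounded, and a cutoff vanishing at the end points makes
  their end values agree.\<close>

lemma fejer_converges_bounded:
  assumes f: "integrable leb f" and B: "B > 0" "\<And>x. cmod (f x) \<le> B"
  shows "fejer_converges f"
proof -
  have "f measurable_on {-pi..pi}"
    using f measurable_on_iff_borel_measurable[of "{-pi..pi}" f] by auto
  then obtain N g where N: "negligible N" and g: "\<And>n. continuous_on UNIV (g n)"
    and lim: "\<And>x. x \<notin> N \<Longrightarrow> (\<lambda>n. g n x) \<longlonglongrightarrow> (if x \<in> {-pi..pi} then f x else 0)"
    unfolding measurable_on_def by blast
  \<comment> \<open>The cutoff is 0 at both end points and eventually equals 1 at every interior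
    point. Outside the interval it is negative and unbounded, so \<open>h'\<close> replaces the
    values there by 0.\<close>
  define h where "h n \<theta> = of_real (min 1 (real n * (pi - \<bar>\<theta>\<bar>))) * radial_clamp B (g n \<theta>)" for n \<theta>
  define h' where "h' n \<theta> = (if \<theta> \<in> {-pi..pi} then h n \<theta> else 0)" for n \<theta>
  show ?thesis
  proof (rule fejer_converges_dominated[OF f, where g = h' and w = "\<lambda>_. 2 * B"])
    show "fejer_converges (h' n)" for n
    proof (rule fejer_converges_continuous)
      have "continuous_on {-pi..pi} (h n)"
        unfolding h_def by (intro continuous_intros continuous_on_radial_clamp B continuous_on_subset[OF g]) auto
      then show "continuous_on {-pi..pi} (h' n)" by (rule continuous_on_eq) (simp add: h'_def)
    qed (simp add: h'_def h_def)
    have "negligible (N \<union> {-pi, pi})" using N by simp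
    then have "AE x in lebesgue. x \<notin> N \<union> {-pi, pi}"
      by (intro AE_not_in) (simp only: negligible_iff_null_sets)
    then have "AE x in leb. x \<notin> N \<union> {-pi, pi}"
      by (subst AE_restrict_space_iff, simp) (erule eventually_mono, blast)
    moreover have "AE x in leb. x \<in> {-pi..pi}" by (rule AE_I2) simp
    ultimately show "AE x in leb. (\<lambda>n. h' n x) \<longlonglongrightarrow> f x"
    proof eventually_elim
      case (elim x)
      then have x: "\<bar>x\<bar> < pi" by auto
      have "(\<lambda>n. radial_clamp B (g n x)) \<longlonglongrightarrow> radial_clamp B (f x)"
        using lim[of x] elim continuous_on_tendsto_compose[OF continuous_on_radial_clamp[OF B(1) continuous_on_id, of UNIV]]
        by simp
      then have 1: "(\<lambda>n. radial_clamp B (g n x)) \<longlonglongrightarrow> f x" using B(2) by (simp add: radial_clamp_eq)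
      have "filterlim (\<lambda>n. real n * (pi - \<bar>x\<bar>)) at_top sequentially"
        using x by (intro filterlim_at_top_mult_tendsto_pos[OF tendsto_const _ filterlim_real_sequentially, THEN filterlim_cong[THEN iffD1, rotated -1]]) (auto simp: mult.commute)
      then have "\<forall>\<^sub>F n in sequentially. real n * (pi - \<bar>x\<bar>) \<ge> 1"
        by (simp add: filterlim_at_top)
      then have "\<forall>\<^sub>F n in sequentially. radial_clamp B (g n x) = h' n x"
        by eventually_elim (use elim in \<open>simp add: h'_def h_def\<close>)
      with 1 show ?case by (rule Lim_transform_eventually)
    qed
    show "cmod (f \<theta> - h' n \<theta>) \<le> 2 * B" for n \<theta>
    proof -
      have "cmod (h' n \<theta>) \<le> 1 * B"
      proof (cases "\<theta> \<in> {-pi..pi}")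
        case True
        then have "\<bar>min 1 (real n * (pi - \<bar>\<theta>\<bar>))\<bar> \<le> 1" by auto
        then have "\<bar>min 1 (real n * (pi - \<bar>\<theta>\<bar>))\<bar> * cmod (radial_clamp B (g n \<theta>)) \<le> 1 * B"
          by (intro mult_mono radial_clamp_norm_le B) auto
        then show ?thesis
          using True by (simp only: h'_def h_def norm_mult norm_of_real if_True)
      next
        case False
        then show ?thesis using B by (simp only: h'_def if_False) simp
      qed
      then show ?thesis using B(2)[of \<theta>] norm_triangle_ineq4[of "f \<theta>" "h' n \<theta>"] by linarith
    qed
  qed (simp add: finite_measure.integrable_const[OF finite_measure_leb])
qed

text \<open>Clamped versions of \<open>f\<close> are bounded and eventually equal \<open>f\<close>
  at each point, with error at most \<open>2 * cmod (f x)\<close>. The radius \<open>Suc n\<close>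
  is always positive.\<close>

lemma fejer_convergence:
  assumes f: "integrable leb f"
  shows "fejer_converges f"
proof (rule fejer_converges_dominated[OF f, where g = "\<lambda>n x. radial_clamp (real (Suc n)) (f x)" and w = "\<lambda>x. 2 * cmod (f x)"])
  have [measurable]: "f \<in> borel_measurable leb" using f by auto
  show "fejer_converges (\<lambda>x. radial_clamp (real (Suc n)) (f x))" for n
  proof (rule fejer_converges_bounded[where B = "real (Suc n)"])
    show "integrable leb (\<lambda>x. radial_clamp (real (Suc n)) (f x))"
    proof (rule Bochner_Integration.integrable_bound[OF f])
      show "(\<lambda>x. radial_clamp (real (Suc n)) (f x)) \<in> borel_measurable leb"
        unfolding radial_clamp_def by measurable
    qed (simp add: radial_clamp_norm_le')
  qed (simp_all add: radial_clamp_norm_le)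
  show "AE x in leb. (\<lambda>n. radial_clamp (real (Suc n)) (f x)) \<longlonglongrightarrow> f x"
  proof (rule AE_I2)
    fix x
    obtain N where "cmod (f x) \<le> real N" using real_arch_simple by blast
    then have "\<forall>n\<ge>N. f x = radial_clamp (real (Suc n)) (f x)"
      by (auto simp: radial_clamp_eq)
    then have "\<forall>\<^sub>F n in sequentially. f x = radial_clamp (real (Suc n)) (f x)"
      by (auto simp: eventually_sequentially)
    with tendsto_const show "(\<lambda>n. radial_clamp (real (Suc n)) (f x)) \<longlonglongrightarrow> f x" by (rule Lim_transform_eventually)
  qed
  show "cmod (f x - radial_clamp (real (Suc n)) (f x)) \<le> 2 * cmod (f x)" for n x
    using norm_triangle_ineq4[of "f x" "radial_clamp (real (Suc n)) (f x)"] radial_clamp_norm_le'[of "real (Suc n)" "f x"] by linarith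
qed (use f in simp)

text \<open>Pairs \<open>(i, j)\<close> are grouped by their difference \<open>k\<close>. Real
  Fourier coefficients give real \<open>c\<close>, as the moment computation for trigonometric
  polynomials requires.\<close>

lemma fejer_eq_trigpoly:
  assumes "\<forall>k. fourier_coeff f k \<in> \<real>"
  obtains c where "\<And>k. \<bar>k\<bar> > int N \<Longrightarrow> c k = 0" "fejer N f = trigpoly N c"
proof -
  define P where "P k = {x \<in> {..N} \<times> {..N}. int (fst x) - int (snd x) = k}" for k
  define c where "c k = real (card (P k)) * Re (fourier_coeff f k) / real (Suc N)" for k
  have "c k = 0" if "\<bar>k\<bar> > int N" for k
  proof -
    have "P k = {}" using that by (auto simp: P_def)
    then show ?thesis by (simp add: c_def)
  qed
  moreover have "fejer N f \<theta> = trigpoly N c \<theta>" for \<theta>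
  proof -
    have "(\<Sum>i\<le>N. \<Sum>j\<le>N. fourier_coeff f (int i - int j) * cis (of_int (int i - int j) * \<theta>))
      = (\<Sum>x\<in>{..N} \<times> {..N}. fourier_coeff f (int (fst x) - int (snd x)) * cis (of_int (int (fst x) - int (snd x)) * \<theta>))"
      by (simp add: sum.cartesian_product case_prod_beta)
    also have "\<dots> = (\<Sum>k=-int N..int N. \<Sum>x\<in>P k. fourier_coeff f (int (fst x) - int (snd x)) * cis (of_int (int (fst x) - int (snd x)) * \<theta>))"
      unfolding P_def by (rule sum.group[symmetric]) auto
    also have "\<dots> = (\<Sum>k=-int N..int N. \<Sum>x\<in>P k. fourier_coeff f k * cis (of_int k * \<theta>))"
      by (intro sum.cong refl) (auto simp: P_def)
    also have "\<dots> = (\<Sum>k=-int N..int N. of_nat (Suc N) * (of_real (c k) * cis (of_int k * \<theta>)))"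
    proof (intro sum.cong refl)
      fix k
      have "fourier_coeff f k = of_real (Re (fourier_coeff f k))" using assms by (simp add: of_real_Re)
      then show "(\<Sum>x\<in>P k. fourier_coeff f k * cis (of_int k * \<theta>)) = of_nat (Suc N) * (of_real (c k) * cis (of_int k * \<theta>))"
        by (simp add: c_def del: of_nat_Suc)
    qed
    finally show ?thesis unfolding fejer_def trigpoly_def sum_distrib_left[symmetric] by (simp del: of_nat_Suc)
  qed
  ultimately show thesis using that by blast
qed

subsection \<open>Spectral distribution\<close>

lemma anti_identity_times_toeplitz:
  "anti_identity_mat n * toeplitz_mat f n = Matrix.mat n n (\<lambda>(s, t). hankel f n s t)"
proof (rule eq_matI)
  fix s t assume "s < dim_row (Matrix.mat n n (\<lambda>(s, t). hankel f n s t))"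
    "t < dim_col (Matrix.mat n n (\<lambda>(s, t). hankel f n s t))"
  then have s: "s < n" and t: "t < n" by simp_all
  have "(anti_identity_mat n * toeplitz_mat f n) $$ (s, t)
    = (\<Sum>x<n. (if s + x + 1 = n then 1 else 0) * fourier_coeff f (int x - int t))"
    using s t by (simp add: anti_identity_mat_def toeplitz_mat_def scalar_prod_def lessThan_atLeast0)
  also have "\<dots> = (\<Sum>x<n. if x = n - 1 - s then fourier_coeff f (int x - int t) else 0)"
    using s by (intro sum.cong refl) auto
  also have "\<dots> = hankel f n s t" using s by (simp add: of_nat_diff algebra_simps)
  finally show "(anti_identity_mat n * toeplitz_mat f n) $$ (s, t) = Matrix.mat n n (\<lambda>(s, t). hankel f n s t) $$ (s, t)"
    using s t by simp
qed (simp_all add: anti_identity_mat_def toeplitz_mat_def)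

text \<open>The entries depend only on \<open>s + t\<close> and are real, so the matrix is symmetric
  and Hermitian.\<close>

lemma hankel_spectral:
  assumes "\<forall>k. fourier_coeff f k \<in> \<real>"
  obtains l u where "spectral_data n (hankel f n) l u"
    and "proots (char_poly (anti_identity_mat n * toeplitz_mat f n)) = image_mset (\<lambda>i. complex_of_real (l i)) (mset_set {..<n})"
proof -
  define A where "A = Matrix.mat n n (\<lambda>(s, t). hankel f n s t)"
  have herm: "A $$ (t, s) = cnj (A $$ (s, t))" if "s < n" "t < n" for s t
  proof -
    have "cnj (fourier_coeff f k) = fourier_coeff f k" for k using assms by (simp add: Reals_cnj_iff)
    moreover have "hankel f n t s = hankel f n s t" by (rule arg_cong[of _ _ "fourier_coeff f"]) simp
    ultimately show ?thesis using that by (simp add: A_def)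
  qed
  obtain l u where lu: "spectral_data n (\<lambda>s t. A $$ (s, t)) l u"
    "proots (char_poly A) = image_mset (\<lambda>i. complex_of_real (l i)) (mset_set {..<n})"
  proof (rule hermitian_spectral)
    show "A \<in> carrier_mat n n" by (simp add: A_def)
  qed (use herm in blast)+
  have "spectral_data n (hankel f n) l u"
    using lu(1) unfolding spectral_data_def by (simp add: A_def)
  with lu(2) show thesis using that unfolding anti_identity_times_toeplitz A_def by blast
qed

lemma cos_Lipschitz: "\<bar>cos x - cos y\<bar> \<le> \<bar>x - y\<bar>" for x y :: real
proof -
  have "\<bar>cos x - cos y\<bar> = 2 * (\<bar>sin ((x + y) / 2)\<bar> * \<bar>sin ((y - x) / 2)\<bar>)"
    by (simp add: cos_diff_cos abs_mult)
  also have "\<bar>sin ((x + y) / 2)\<bar> * \<bar>sin ((y - x) / 2)\<bar> \<le> 1 * \<bar>(y - x) / 2\<bar>"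
    by (intro mult_mono abs_sin_le_one abs_sin_x_le_abs_x) auto
  finally show ?thesis by (simp add: abs_minus_commute)
qed

text \<open>A Fejer mean replaces \<open>f\<close> by a trigonometric polynomial. The resulting
  errors in the spectral average, uniformly in \<open>n\<close>, and in the limit are both at most
  \<open>\<bar>t\<bar> / (2 * pi)\<close> times the distance in the mean.\<close>

lemma hankel_trace_iexp_limit:
  assumes f: "integrable leb f" and re: "\<forall>k. fourier_coeff f k \<in> \<real>"
    and sd: "\<And>n. spectral_data n (hankel f n) (l n) (u n)"
  shows "(\<lambda>n. (\<Sum>j<n. cis (t * l n j)) / of_nat n) \<longlonglongrightarrow> of_real (1 / (2 * pi) * (LINT \<theta>|leb. cos (t * cmod (f \<theta>))))"
proof (rule LIMSEQ_I)
  fix e :: real assume e: "e > 0"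
  \<comment> \<open>This gives \<open>\<bar>t\<bar> * d \<le> e\<close>, and
    \<open>2 * pi > 3\<close> turns it into an error below \<open>e / 3\<close>. The added 1 covers
    \<open>t = 0\<close>.\<close>
  define d where "d = e / (\<bar>t\<bar> + 1)"
  have d: "d > 0" using e by (simp add: d_def)
  have td: "\<bar>t\<bar> * d / (2 * pi) < e / 3"
  proof -
    have "\<bar>t\<bar> * d \<le> e" using e by (simp add: d_def field_simps)
    then have "\<bar>t\<bar> * d / (2 * pi) \<le> e / (2 * pi)" by (intro divide_right_mono) auto
    also have "\<dots> < e / 3" using e pi_gt3 by (intro divide_strict_left_mono) auto
    finally show ?thesis .
  qed
  have "(\<lambda>N. LINT \<theta>|leb. cmod (fejer N f \<theta> - f \<theta>)) \<longlonglongrightarrow> 0"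
    using fejer_convergence[OF f] by (simp add: fejer_converges_def)
  from order_tendstoD(2)[OF this d] obtain r where r: "(LINT \<theta>|leb. cmod (fejer r f \<theta> - f \<theta>)) < d"
    by (auto simp: eventually_sequentially)
  obtain c where c: "\<And>k. \<bar>k\<bar> > int r \<Longrightarrow> c k = 0" and q: "fejer r f = trigpoly r c"
    using fejer_eq_trigpoly[OF re] by blast
  define D where "D = (LINT \<theta>|leb. cmod (f \<theta> - trigpoly r c \<theta>))"
  have D: "D < d" using r by (simp add: D_def q norm_minus_commute)
  have "\<forall>k. fourier_coeff (trigpoly r c) k \<in> \<real>" by (simp add: fourier_coeff_trigpoly)
  then have "\<exists>m w. spectral_data n (hankel (trigpoly r c) n) m w" for n
    using hankel_spectral by metis
  then obtain m w where mw: "\<And>n. spectral_data n (hankel (trigpoly r c) n) (m n) (w n)" by metis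
  define L where "L h = (1 / (2 * pi) * (LINT \<theta>|leb. cos (t * cmod (h \<theta>))))" for h :: "real \<Rightarrow> complex"
  have lim: "(\<lambda>n. (\<Sum>j<n. cis (t * m n j)) / of_nat n) \<longlonglongrightarrow> of_real (L (trigpoly r c))"
    unfolding L_def by (rule trigpoly_trace_iexp_limit[OF c mw])
  obtain N where N: "\<And>n. n \<ge> N \<Longrightarrow> cmod ((\<Sum>j<n. cis (t * m n j)) / of_nat n - of_real (L (trigpoly r c))) < e / 3"
    using LIMSEQ_D[OF lim, of "e / 3"] e by auto
  have 1: "cmod ((\<Sum>j<n. cis (t * l n j)) / of_nat n - (\<Sum>j<n. cis (t * m n j)) / of_nat n) < e / 3" for n
  proof (cases "n = 0")
    case False
    have "cmod ((\<Sum>j<n. cis (t * l n j)) - (\<Sum>j<n. cis (t * m n j))) \<le> real n / (2 * pi) * D * \<bar>t\<bar>"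
      unfolding D_def by (rule hankel_trace_iexp_Lipschitz[OF f integrable_trigpoly sd mw])
    then have "cmod ((\<Sum>j<n. cis (t * l n j)) - (\<Sum>j<n. cis (t * m n j))) / real n \<le> \<bar>t\<bar> * D / (2 * pi)"
      using False by (simp add: field_simps)
    also have "\<dots> \<le> \<bar>t\<bar> * d / (2 * pi)" using D by (intro divide_right_mono mult_left_mono) auto
    finally show ?thesis using td by (simp add: norm_divide flip: diff_divide_distrib)
  qed (use e in simp)
  have 2: "\<bar>L (trigpoly r c) - L f\<bar> < e / 3"
  proof -
    have int: "integrable leb (\<lambda>\<theta>. cos (t * cmod (h \<theta>)))" if "integrable leb h" for h :: "real \<Rightarrow> complex"
      using that by (intro finite_measure.integrable_const_bound[OF finite_measure_leb, where B=1]) auto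
    have "\<bar>(LINT \<theta>|leb. cos (t * cmod (trigpoly r c \<theta>))) - (LINT \<theta>|leb. cos (t * cmod (f \<theta>)))\<bar>
      = \<bar>LINT \<theta>|leb. cos (t * cmod (trigpoly r c \<theta>)) - cos (t * cmod (f \<theta>))\<bar>"
      using int[OF f] int[OF integrable_trigpoly] by simp
    also have "\<dots> \<le> (LINT \<theta>|leb. \<bar>cos (t * cmod (trigpoly r c \<theta>)) - cos (t * cmod (f \<theta>))\<bar>)"
      by (rule integral_abs_bound)
    also have "\<dots> \<le> (LINT \<theta>|leb. \<bar>t\<bar> * cmod (f \<theta> - trigpoly r c \<theta>))"
    proof (rule Bochner_Integration.integral_mono)
      fix \<theta>
      have "\<bar>t * cmod (trigpoly r c \<theta>) - t * cmod (f \<theta>)\<bar> \<le> \<bar>t\<bar> * cmod (f \<theta> - trigpoly r c \<theta>)"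
        unfolding right_diff_distrib[symmetric] abs_mult
        by (intro mult_left_mono) (metis norm_minus_commute norm_triangle_ineq3, simp)
      then show "\<bar>cos (t * cmod (trigpoly r c \<theta>)) - cos (t * cmod (f \<theta>))\<bar> \<le> \<bar>t\<bar> * cmod (f \<theta> - trigpoly r c \<theta>)"
        using cos_Lipschitz order_trans by blast
    qed (use f int[OF f] int[OF integrable_trigpoly] integrable_trigpoly in auto)
    also have "\<dots> = \<bar>t\<bar> * D" by (simp add: D_def)
    also have "\<dots> \<le> \<bar>t\<bar> * d" using D by (intro mult_left_mono) auto
    finally have le: "\<bar>(LINT \<theta>|leb. cos (t * cmod (trigpoly r c \<theta>))) - (LINT \<theta>|leb. cos (t * cmod (f \<theta>)))\<bar> \<le> \<bar>t\<bar> * d" .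
    have "\<bar>L (trigpoly r c) - L f\<bar> = \<bar>(LINT \<theta>|leb. cos (t * cmod (trigpoly r c \<theta>))) - (LINT \<theta>|leb. cos (t * cmod (f \<theta>)))\<bar> / (2 * pi)"
      by (simp add: L_def abs_divide flip: diff_divide_distrib)
    also have "\<dots> \<le> \<bar>t\<bar> * d / (2 * pi)" using le by (intro divide_right_mono) auto
    finally show ?thesis using td by linarith
  qed
  have "cmod ((\<Sum>j<n. cis (t * l n j)) / of_nat n - of_real (L f)) < e" if "n \<ge> N" for n
  proof -
    have triangle: "cmod (x - of_real b) \<le> cmod (x - y) + (cmod (y - of_real a) + \<bar>a - b\<bar>)" for x y a b
      using norm_triangle_ineq[of "x - y" "(y - of_real a) + of_real (a - b)"]
        norm_triangle_ineq[of "y - of_real a" "of_real (a - b)"] norm_of_real[of "a - b", where 'a = complex] by simp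
    from triangle[of "(\<Sum>j<n. cis (t * l n j)) / of_nat n" "L f" "(\<Sum>j<n. cis (t * m n j)) / of_nat n" "L (trigpoly r c)"]
    show ?thesis using 1[of n] 2 N[OF that] by linarith
  qed
  then show "\<exists>N. \<forall>n\<ge>N. norm ((\<Sum>j<n. cis (t * l n j)) / of_nat n
     - of_real (1 / (2 * pi) * (LINT \<theta>|leb. cos (t * cmod (f \<theta>))))) < e"
    unfolding L_def by blast
qed

section \<open>Periodicity and integration over the doubled domain\<close>

abbreviation leb2 :: "real measure" where "leb2 \<equiv> lebesgue_on {-2 * pi..2 * pi}"

text \<open>The larger interval is covered by the basic period and its two translates, on which
  \<open>f\<close> is glued from shifted copies.\<close>

lemma periodic_borel_measurable:
  fixes f :: "real \<Rightarrow> complex"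
  assumes f: "f \<in> borel_measurable leb" and per: "\<forall>\<theta>. f (\<theta> + 2 * pi) = f \<theta>"
  shows "f \<in> borel_measurable leb2"
proof -
  define F where "F x = (if x \<in> {-pi..pi} then f x else 0)" for x
  have F: "F \<in> borel_measurable lebesgue"
    using f unfolding F_def by (subst borel_measurable_if) auto
  have Fc: "(\<lambda>x. F (c + x)) \<in> borel_measurable lebesgue" for c
    using borel_measurable_affine[OF F, of 1 c] by simp
  define f' where "f' x = (if x < -pi then F (2 * pi + x) else if x > pi then F (- (2 * pi) + x) else F x)" for x
  have "f' \<in> borel_measurable lebesgue"
    unfolding f'_def using F Fc[of "2 * pi"] Fc[of "- (2 * pi)"] by (intro measurable_If) auto
  then have m: "f' \<in> borel_measurable leb2" by (rule measurable_restrict_space1)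
  have eq: "f' x = f x" if "x \<in> space leb2" for x
  proof -
    have "f (x - 2 * pi) = f x" using per[rule_format, of "x - 2 * pi"] by simp
    moreover have "f (x + 2 * pi) = f x" using per by simp
    ultimately show ?thesis using that by (auto simp: f'_def F_def add.commute)
  qed
  show ?thesis by (rule iffD1[OF measurable_cong[OF eq] m])
qed

lemma integral_periodic:
  fixes k :: "real \<Rightarrow> complex"
  assumes per: "\<And>x. k (x + 2 * pi) = k x" and int: "k integrable_on {-2 * pi..2 * pi}"
  shows "integral {-2 * pi..0} k = integral {-pi..pi} k" and "integral {0..2 * pi} k = integral {-pi..pi} k"
proof -
  have i: "k integrable_on {a..b}" if "-2 * pi \<le> a" "b \<le> 2 * pi" for a b
    using that by (intro integrable_on_subinterval[OF int]) auto
  have "integral {0..2 * pi} k = integral {0..pi} k + integral {pi..2 * pi} k"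
    by (rule Henstock_Kurzweil_Integration.integral_combine[symmetric]) (auto intro: i)
  also have "integral {pi..2 * pi} k = integral {-pi..0} k"
    using integral_shift_real_ivl[of pi "2 * pi" "2 * pi" k] by (simp add: per)
  also have "integral {0..pi} k + integral {-pi..0} k = integral {-pi..pi} k"
    using Henstock_Kurzweil_Integration.integral_combine[of "-pi" 0 pi k] by (simp add: i add.commute)
  finally show 1: "integral {0..2 * pi} k = integral {-pi..pi} k" .
  have "integral {-2 * pi..0} k = integral {0..2 * pi} k"
    using integral_shift_real_ivl[of 0 "2 * pi" "2 * pi" k] by (simp add: per)
  with 1 show "integral {-2 * pi..0} k = integral {-pi..pi} k" by simp
qed

lemma finite_measure_leb2: "finite_measure leb2"
  by (rule finite_measure_lebesgue_on) simp

text \<open>Periodicity removes the shift in \<open>psi\<close>, leaving \<open>g\<close> with a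
  sign depending on the half of the domain.\<close>

lemma psi_measurable:
  fixes g :: "real \<Rightarrow> real"
  assumes g: "g \<in> borel_measurable leb2" and per: "\<And>x. g (x + 2 * pi) = g x"
  shows "psi g \<in> borel_measurable leb2"
proof -
  have eq: "psi g = (\<lambda>x. if 0 \<le> x then g x else - g x)" by (auto simp: psi_def per)
  show ?thesis unfolding eq
    by (intro measurable_If borel_measurable_uminus g) (auto simp: sets_restrict_space_iff space_restrict_space intro!: sets_restrict_space_iff)
qed

text \<open>Each half of the domain is one full period, the right half carrying \<open>g\<close> and
  the left half \<open>- g\<close>.\<close>

lemma LINT_psi:
  fixes g :: "real \<Rightarrow> real" and G :: "real \<Rightarrow> complex"
  assumes g: "g \<in> borel_measurable leb2" and per: "\<And>x. g (x + 2 * pi) = g x"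
    and G: "continuous_on UNIV G" and B: "\<And>x. cmod (G x) \<le> B"
  shows "(LINT x|leb2. G (psi g x)) = (LINT x|leb. G (g x) + G (- g x))"
proof -
  have Gm: "(\<lambda>x. G (h x)) \<in> borel_measurable M" if "h \<in> borel_measurable M" for h and M :: "real measure"
    using measurable_compose[OF that borel_measurable_continuous_onI[OF G]] .
  have int2: "integrable leb2 (\<lambda>x. G (h x))" if "h \<in> borel_measurable leb2" for h
    using Gm[OF that] B by (intro finite_measure.integrable_const_bound[OF finite_measure_leb2, where B=B]) auto
  have on: "(\<lambda>x. G (h x)) integrable_on {-2 * pi..2 * pi}" if "h \<in> borel_measurable leb2" for h
    using int2[OF that] by (simp add: integrable_on_lebesgue_on)
  have hk: "(LINT x|lebesgue_on S. G (h x)) = integral S (\<lambda>x. G (h x))"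
    if "h \<in> borel_measurable leb2" "S \<in> lmeasurable" "S \<subseteq> {-2 * pi..2 * pi}" for h S
  proof -
    have "h \<in> borel_measurable (lebesgue_on S)"
      using measurable_restrict_mono[OF that(1,3)] .
    then have "integrable (lebesgue_on S) (\<lambda>x. G (h x))"
      using Gm B that by (intro finite_measure.integrable_const_bound[OF finite_measure_lebesgue_on, where B=B]) auto
    then show ?thesis using that by (intro lebesgue_integral_eq_integral) auto
  qed
  have mg: "(\<lambda>x. - g x) \<in> borel_measurable leb2" using g by simp
  have pm: "psi g \<in> borel_measurable leb2" by (rule psi_measurable[OF g per])
  have sub: "{-pi..pi} \<subseteq> {-2 * pi..2 * pi}" by auto
  have "(LINT x|leb2. G (psi g x)) = integral {-2 * pi..2 * pi} (\<lambda>x. G (psi g x))"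
    by (rule hk[OF pm]) auto
  also have "\<dots> = integral {-2 * pi..0} (\<lambda>x. G (psi g x)) + integral {0..2 * pi} (\<lambda>x. G (psi g x))"
    by (rule Henstock_Kurzweil_Integration.integral_combine[symmetric]) (simp, simp, rule on[OF pm])
  \<comment> \<open>Only at 0, which belongs to the positive branch of \<open>psi\<close>, can the
    integrands differ.\<close>
  also have "integral {-2 * pi..0} (\<lambda>x. G (psi g x)) = integral {-2 * pi..0} (\<lambda>x. G (- g x))"
    by (rule integral_spike[of "{0}"]) (auto simp: psi_def per)
  also have "\<dots> = integral {-pi..pi} (\<lambda>x. G (- g x))"
    by (rule integral_periodic) (simp add: per, rule on[OF mg])
  also have "integral {0..2 * pi} (\<lambda>x. G (psi g x)) = integral {0..2 * pi} (\<lambda>x. G (g x))"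
    by (rule integral_cong) (auto simp: psi_def)
  also have "\<dots> = integral {-pi..pi} (\<lambda>x. G (g x))"
    by (rule integral_periodic) (simp add: per, rule on[OF g])
  also have "integral {-pi..pi} (\<lambda>x. G (- g x)) = (LINT x|leb. G (- g x))"
    using hk[OF mg _ sub] by simp
  also have "integral {-pi..pi} (\<lambda>x. G (g x)) = (LINT x|leb. G (g x))"
    using hk[OF g _ sub] by simp
  also have "(LINT x|leb. G (- g x)) + (LINT x|leb. G (g x)) = (LINT x|leb. G (g x) + G (- g x))"
  proof -
    have "g \<in> borel_measurable leb" using measurable_restrict_mono[OF g sub] .
    then have "integrable leb (\<lambda>x. G (g x))" "integrable leb (\<lambda>x. G (- g x))"
      using Gm B by (auto intro!: finite_measure.integrable_const_bound[OF finite_measure_leb, where B=B])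
    then show ?thesis by simp
  qed
  finally show ?thesis .
qed

section \<open>Empirical spectral measures and the limit law\<close>

definition empirical :: "nat \<Rightarrow> (nat \<Rightarrow> real) \<Rightarrow> real measure" where
  "empirical n l = distr (measure_pmf (pmf_of_set {..<n})) borel l"

text \<open>This includes \<open>n = 0\<close>: \<open>pmf_of_set {}\<close> is still some
  probability mass function.\<close>

lemma real_distribution_empirical: "real_distribution (empirical n l)"
  unfolding empirical_def by (rule prob_space.real_distribution_distr) (simp_all add: measure_pmf.prob_space_axioms)

lemma integral_empirical:
  fixes g :: "real \<Rightarrow> complex"
  assumes "n > 0" "g \<in> borel_measurable borel"
  shows "integral\<^sup>L (empirical n l) g = (\<Sum>j<n. g (l j)) / of_nat n"
proof -
  have "{..<n} \<noteq> {}" using assms by auto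
  then have "integral\<^sup>L (empirical n l) g = (\<Sum>j<n. (1 / real n) *\<^sub>R g (l j))"
    unfolding empirical_def using assms
    by (subst integral_distr, simp, simp, subst integral_measure_pmf[of "{..<n}"]) (auto simp: pmf_of_set)
  then show ?thesis by (simp add: scaleR_conv_of_real sum_divide_distrib)
qed

text \<open>This is the law of \<open>h\<close> under the uniform distribution on the doubled
  domain, whose length is \<open>4 * pi\<close>.\<close>

definition symbol_distribution :: "(real \<Rightarrow> real) \<Rightarrow> real measure" where
  "symbol_distribution h = distr (density leb2 (\<lambda>_. ennreal (1 / (4 * pi)))) borel h"



lemma real_distribution_symbol_distribution:
  assumes "h \<in> borel_measurable leb2"
  shows "real_distribution (symbol_distribution h)"
  unfolding symbol_distribution_def
proof (rule prob_space.real_distribution_distr)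
  show "prob_space (density leb2 (\<lambda>_. ennreal (1 / (4 * pi))))"
  proof (rule prob_spaceI)
    have "emeasure leb2 (space leb2) = ennreal (4 * pi)"
      by (simp add: emeasure_restrict_space)
    then show "emeasure (density leb2 (\<lambda>_. ennreal (1 / (4 * pi)))) (space (density leb2 (\<lambda>_. ennreal (1 / (4 * pi))))) = 1"
      unfolding space_density emeasure_density_const[OF sets.top] by (simp flip: ennreal_mult)
  qed
qed (use assms in simp)

lemma integral_symbol_distribution:
  fixes g :: "real \<Rightarrow> complex"
  assumes "h \<in> borel_measurable leb2" "g \<in> borel_measurable borel"
  shows "integral\<^sup>L (symbol_distribution h) g = (LINT x|leb2. g (h x)) / of_real (4 * pi)"
  unfolding symbol_distribution_def using assms
  by (subst integral_distr) (simp_all add: integral_density measurable_compose[OF assms] scaleR_conv_of_real)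

lemma bounded_of_bounded_support:
  fixes F :: "complex \<Rightarrow> complex"
  assumes F: "continuous_on UNIV F" and supp: "bounded {z. F z \<noteq> 0}"
  obtains B where "\<And>z. cmod (F z) \<le> B"
proof -
  obtain R where R: "\<And>z. F z \<noteq> 0 \<Longrightarrow> cmod z \<le> R" using supp by (auto simp: bounded_iff)
  have "compact (F ` cball 0 R)"
    by (intro compact_continuous_image continuous_on_subset[OF F]) auto
  then obtain B where B: "\<And>z. z \<in> cball 0 R \<Longrightarrow> cmod (F z) \<le> B"
    using compact_imp_bounded bounded_iff by (metis imageI)
  have "cmod (F z) \<le> max B 0" for z
    using B[of z] R[of z] by (cases "F z = 0") auto
  then show thesis using that by blast
qed

theorem theorem3p2:
  fixes f :: "real \<Rightarrow> complex"
  assumes "f absolutely_integrable_on {-pi..pi}"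
    and "\<forall>k. fourier_coeff f k \<in> \<real>"
    and "\<forall>\<theta>. f (\<theta> + 2 * pi) = f \<theta>"
  shows "eigenvalue_distribution
           (\<lambda>n. anti_identity_mat n * toeplitz_mat f n)
           (\<lambda>\<theta>. complex_of_real (psi (\<lambda>x. cmod (f x)) \<theta>))
           {-2 * pi..2 * pi}"
proof -
  have f: "integrable leb f" using assms(1) by (simp add: integrable_leb_iff)
  define g where "g x = cmod (f x)" for x
  have per: "g (x + 2 * pi) = g x" for x using assms(3) by (simp add: g_def)
  have "f \<in> borel_measurable leb2" using f assms(3) by (intro periodic_borel_measurable) auto
  then have g: "g \<in> borel_measurable leb2" unfolding g_def[abs_def] by simp
  have pm: "psi g \<in> borel_measurable leb2" by (rule psi_measurable[OF g per])
  have "\<exists>l u. spectral_data n (hankel f n) l u \<and>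
      proots (char_poly (anti_identity_mat n * toeplitz_mat f n)) = image_mset (\<lambda>i. complex_of_real (l i)) (mset_set {..<n})" for n
    using hankel_spectral[OF assms(2), of n] by metis
  then obtain l u where sd: "\<And>n. spectral_data n (hankel f n) (l n) (u n)" and
    pr: "\<And>n. proots (char_poly (anti_identity_mat n * toeplitz_mat f n)) = image_mset (\<lambda>i. complex_of_real (l n i)) (mset_set {..<n})"
    by metis
  \<comment> \<open>The shift to \<open>Suc n\<close> keeps the list of eigenvalues nonempty, so
    that integrals against \<open>\<mu> n\<close> are honest averages.\<close>
  define \<mu> where "\<mu> n = empirical (Suc n) (l (Suc n))" for n
  define \<nu> where "\<nu> = symbol_distribution (psi g)"
  have \<nu>: "real_distribution \<nu>" unfolding \<nu>_def by (rule real_distribution_symbol_distribution[OF pm])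
  have "(\<lambda>n. char (\<mu> n) t) \<longlonglongrightarrow> char \<nu> t" for t
  proof -
    have cont: "continuous_on UNIV (\<lambda>x. iexp (t * x))" by (intro continuous_intros)
    have "char \<nu> t = (LINT x|leb2. iexp (t * psi g x)) / of_real (4 * pi)"
      unfolding char_def \<nu>_def
      by (rule integral_symbol_distribution[OF pm]) (rule borel_measurable_continuous_onI[OF cont])
    \<comment> \<open>The two signs of the symbol combine to \<open>2 * cos\<close>, and
      \<open>2 / (4 * pi)\<close> is the factor \<open>1 / (2 * pi)\<close> of
      \<open>hankel_trace_iexp_limit\<close>.\<close>
    also have "(LINT x|leb2. iexp (t * psi g x)) = (LINT x|leb. iexp (t * g x) + iexp (t * - g x))"
      by (rule LINT_psi[OF g per cont, where B=1]) simp
    also have "\<dots> = (LINT x|leb. complex_of_real (2 * cos (t * g x)))"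
      by (intro Bochner_Integration.integral_cong refl) (simp add: complex_eq_iff Re_exp Im_exp)
    also have "\<dots> = of_real (2 * (LINT x|leb. cos (t * g x)))"
      unfolding integral_complex_of_real by simp
    finally have \<nu>_char: "char \<nu> t = of_real (1 / (2 * pi) * (LINT x|leb. cos (t * g x)))" by simp
    have "char (\<mu> n) t = (\<Sum>j<Suc n. cis (t * l (Suc n) j)) / of_nat (Suc n)" for n
      unfolding char_def \<mu>_def
      by (subst integral_empirical) (auto simp: cis_conv_exp intro!: borel_measurable_continuous_onI[OF cont])
    then show ?thesis
      using LIMSEQ_Suc[OF hankel_trace_iexp_limit[OF f assms(2) sd, of t]] unfolding \<nu>_char g_def by simp
  qed
  then have wc: "weak_conv_m \<mu> \<nu>"
    by (intro levy_continuity \<nu>) (simp_all add: \<mu>_def real_distribution_empirical)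
  have "(\<lambda>n. 1 / of_nat n * (\<Sum>z\<in>#proots (char_poly (anti_identity_mat n * toeplitz_mat f n)). F z))
      \<longlonglongrightarrow> 1 / complex_of_real (measure lebesgue {-2 * pi..2 * pi}) * (LINT \<theta>:{-2 * pi..2 * pi}|lebesgue. F (complex_of_real (psi g \<theta>)))"
    if F: "continuous_on UNIV F" "bounded {z. F z \<noteq> 0}" for F :: "complex \<Rightarrow> complex"
  proof -
    obtain B where B: "\<And>z. cmod (F z) \<le> B" using bounded_of_bounded_support[OF F] by blast
    \<comment> \<open>All eigenvalues and symbol values are real, so only the restriction of
      \<open>F\<close> to the real line enters; it is bounded and continuous, as weak convergence
      requires.\<close>
    define h where "h x = F (complex_of_real x)" for x
    have h: "continuous_on UNIV h" unfolding h_def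
      by (intro continuous_on_compose2[OF F(1)] continuous_intros) auto
    have hm: "h \<in> borel_measurable borel" by (rule borel_measurable_continuous_onI[OF h])
    have "(\<lambda>n. integral\<^sup>L (\<mu> n) h) \<longlonglongrightarrow> integral\<^sup>L \<nu> h"
    proof (rule weak_conv_imp_integral_bdd_continuous_conv[OF _ \<nu> wc, where B=B])
      show "real_distribution (\<mu> n)" for n by (simp add: \<mu>_def real_distribution_empirical)
      show "isCont h x" for x using h by (simp add: continuous_on_eq_continuous_at)
      show "norm (h x) \<le> B" for x by (simp add: h_def B)
    qed
    moreover have "integral\<^sup>L (\<mu> n) h = 1 / of_nat (Suc n) * (\<Sum>z\<in>#proots (char_poly (anti_identity_mat (Suc n) * toeplitz_mat f (Suc n))). F z)" for n
    proof -
      have "(\<Sum>z\<in>#image_mset (\<lambda>i. complex_of_real (l (Suc n) i)) (mset_set {..<Suc n}). F z) = (\<Sum>i<Suc n. h (l (Suc n) i))"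
        by (simp only: sum_unfold_sum_mset multiset.map_comp comp_def h_def)
      then show ?thesis
        unfolding \<mu>_def pr by (subst integral_empirical[OF _ hm]) simp_all
    qed
    moreover have "integral\<^sup>L \<nu> h = 1 / complex_of_real (measure lebesgue {-2 * pi..2 * pi}) * (LINT \<theta>:{-2 * pi..2 * pi}|lebesgue. F (complex_of_real (psi g \<theta>)))"
      unfolding \<nu>_def integral_symbol_distribution[OF pm hm] h_def set_lebesgue_integral_def
      by (simp add: integral_restrict_space)
    ultimately show ?thesis by (simp only: LIMSEQ_imp_Suc)
  qed
  moreover have "(\<lambda>\<theta>. complex_of_real (psi g \<theta>)) \<in> borel_measurable leb2" using pm by simp
  moreover have "anti_identity_mat n * toeplitz_mat f n \<in> carrier_mat n n" for n
    by (simp add: anti_identity_times_toeplitz)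
  ultimately show ?thesis
    unfolding eigenvalue_distribution_def g_def[abs_def] by simp
qed

end
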